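(* Assume the Continuum Hypothesis. Then there exists a first countable, zero-dimensional, compact, homogeneous strong $S$-space.
   Context: A space is hereditarily separable (HS) if every subspace of it is separable. An $S$-space is a regular Hausdorff hereditarily separable space which has a non-Lindel\"of subspace. A strong $S$-space is a space $X$ such that $X^n$ is an $S$-space for every positive integer $n$. A space $X$ is homogeneous if for all $x,y \in X$ there is a homeomorphism $f$ of $X$ onto $X$ with $f(x)=y$. *)

theory Defs
  imports "HOL-Analysis.Analysis" "HOL-Library.Equipollence"
begin

definition CH :: bool where
  "CH \<longleftrightarrow> (\<forall>A :: real set. countable A \<or> A \<approx> (UNIV :: real set))"

definition hereditarily_separable :: "'a topology \<Rightarrow> bool" where
  "hereditarily_separable X \<longleftrightarrow>
     (\<forall>S. S \<subseteq> topspace X \<longrightarrow> separable_space (subtopology X S))"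

definition S_space :: "'a topology \<Rightarrow> bool" where
  "S_space X \<longleftrightarrow> regular_space X \<and> Hausdorff_space X \<and> hereditarily_separable X \<and>
     (\<exists>S. S \<subseteq> topspace X \<and> \<not> Lindelof_space (subtopology X S))"

definition strong_S_space :: "'a topology \<Rightarrow> bool" where
  "strong_S_space X \<longleftrightarrow>
     (\<forall>n::nat. n \<ge> 1 \<longrightarrow> S_space (product_topology (\<lambda>_. X) {..<n}))"

definition homogeneous_space :: "'a topology \<Rightarrow> bool" where
  "homogeneous_space X \<longleftrightarrow>
     (\<forall>x \<in> topspace X. \<forall>y \<in> topspace X. \<exists>f. homeomorphic_map X X f \<and> f x = y)"

definition zero_dimensional :: "'a topology \<Rightarrow> bool" where
  "zero_dimensional X \<longleftrightarrow>
     (\<forall>U x. openin X U \<and> x \<in> U \<longrightarrow> (\<exists>V. openin X V \<and> closedin X V \<and> x \<in> V \<and> V \<subseteq> U))"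

end

theory Submission imports Defs begin

text \<open>Under CH the Cantor set \<open>C\<close> is well-ordered with countable initial segments. Recursively choose for
  every \<open>x\<close> a sequence \<open>t x\<close> of earlier points converging to \<open>x\<close> in the Cantor topology and let
  \<open>V m x = {x} \<union> (\<Union>k\<ge>m. V k (t x k))\<close> be the basic neighbourhoods of \<open>x\<close> in a new topology, which
  is locally compact, locally countable and finer than the Cantor topology. At stage \<open>x\<close> only countably
  many sets have to be considered, so \<open>t x\<close> can meet infinitely often each of them that accumulates at
  \<open>x\<close>; treating the coordinates of a tuple in increasing order then shows that a countable
  set of tuples keeps almost all of its Cantor limits, whence all finite powers of the new topology
  are hereditarily separable.

  A duplicate of \<open>C\<close> with the Cantor topology on one copy and the new topology on the other is a compact,
  first countable, zero-dimensional space \<open>X\<close> with a dense set of isolated points. Deleting an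
  isolated point of \<open>X\<close> does not change \<open>X\<close>, and this implies that \<open>Z = X\<^sup>\<omega>\<close> is homeomorphic to each of its
  nonempty clopen subsets. Hence the rings between consecutive members of shrinking clopen
  neighbourhood bases of two points are homeomorphic, and gluing these homeomorphisms proves
  homogeneity. Finally \<open>Z\<^sup>n\<close> is homeomorphic to \<open>Z\<close>.\<close>

section \<open>Clopen neighbourhood bases\<close>

text \<open>A decreasing sequence of sets at each point replaces an explicit topology, so that
  continuity and density become statements about indices. \<open>nbhd_open\<close> and
  \<open>nbhd_closed\<close> make every basic set clopen; with \<open>nbhd_sep\<close> the generated
  space is Hausdorff, zero-dimensional and first countable.\<close>

locale clopen_nbhds =
  fixes N :: "nat \<Rightarrow> 'a \<Rightarrow> 'a set"
  assumes nbhd_self: "x \<in> N m x"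
    and nbhd_anti: "m \<le> k \<Longrightarrow> N k x \<subseteq> N m x"
    and nbhd_open: "y \<in> N m x \<Longrightarrow> \<exists>k. N k y \<subseteq> N m x"
    and nbhd_closed: "y \<notin> N m x \<Longrightarrow> \<exists>k. N k y \<inter> N m x = {}"
    and nbhd_sep: "x \<noteq> y \<Longrightarrow> \<exists>m. y \<notin> N m x"

definition nbhd_topology :: "(nat \<Rightarrow> 'a \<Rightarrow> 'a set) \<Rightarrow> 'a topology" where
  "nbhd_topology N = topology (\<lambda>U. \<forall>x\<in>U. \<exists>m. N m x \<subseteq> U)"

definition nbhd_continuous :: "(nat \<Rightarrow> 'a \<Rightarrow> 'a set) \<Rightarrow> (nat \<Rightarrow> 'b \<Rightarrow> 'b set) \<Rightarrow> ('a \<Rightarrow> 'b) \<Rightarrow> bool" where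
  "nbhd_continuous N N' f \<longleftrightarrow> (\<forall>x m. \<exists>k. f ` N k x \<subseteq> N' m (f x))"

definition clopen_set :: "(nat \<Rightarrow> 'a \<Rightarrow> 'a set) \<Rightarrow> 'a set \<Rightarrow> bool" where
  "clopen_set N A \<longleftrightarrow> (\<forall>x. \<exists>m. N m x \<subseteq> A \<or> N m x \<inter> A = {})"

text \<open>For clopen \<open>A\<close> and \<open>B\<close> this says that the subspaces \<open>A\<close> and \<open>B\<close> are homeomorphic: a
  continuous map on a clopen set extends continuously to the whole space.\<close>

definition clopen_equiv :: "(nat \<Rightarrow> 'a \<Rightarrow> 'a set) \<Rightarrow> 'a set \<Rightarrow> 'a set \<Rightarrow> bool" where
  "clopen_equiv N A B \<longleftrightarrow> (\<exists>f g. nbhd_continuous N N f \<and> nbhd_continuous N N g \<and>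
     f ` A \<subseteq> B \<and> g ` B \<subseteq> A \<and> (\<forall>x\<in>A. g (f x) = x) \<and> (\<forall>y\<in>B. f (g y) = y))"

text \<open>One index bounds both the restricted coordinates and the size of their neighbourhoods,
  so the countable power has a base of the same kind as its factor.\<close>

definition power_nbhd :: "(nat \<Rightarrow> 'a \<Rightarrow> 'a set) \<Rightarrow> nat \<Rightarrow> (nat \<Rightarrow> 'a) \<Rightarrow> (nat \<Rightarrow> 'a) set" where
  "power_nbhd N m z = {w. \<forall>i<m. w i \<in> N m (z i)}"

text \<open>Merges finitely many indices, one per coordinate or ladder step, into one: persistence
  of \<open>Q\<close> lets the maximum work.\<close>

lemma ex_uniform_bound:
  fixes Q :: "nat \<Rightarrow> nat \<Rightarrow> bool"
  assumes "\<And>i k k'. Q i k \<Longrightarrow> k \<le> k' \<Longrightarrow> Q i k'" "\<And>i. i < m \<Longrightarrow> \<exists>k. Q i k"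
  shows "\<exists>k. \<forall>i<m. Q i k"
  using assms(2)
proof (induction m)
  case (Suc m)
  then obtain k k' where "\<forall>i<m. Q i k" "Q m k'"
    by (metis less_Suc_eq)
  then have "\<forall>i<Suc m. Q i (max k k')"
    by (metis assms(1) less_Suc_eq max.cobounded1 max.cobounded2)
  then show ?case by blast
qed simp

lemma nbhd_continuous_const: "(\<And>m. c \<in> N' m c) \<Longrightarrow> nbhd_continuous N N' (\<lambda>_. c)"
  by (auto simp: nbhd_continuous_def)

lemma nbhd_continuous_id: "nbhd_continuous N N (\<lambda>x. x)"
  by (auto simp: nbhd_continuous_def)

lemma nbhd_continuous_compose:
  assumes "nbhd_continuous N N' f" "nbhd_continuous N' N'' g"
  shows "nbhd_continuous N N'' (\<lambda>x. g (f x))"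
  unfolding nbhd_continuous_def
proof (intro allI)
  fix x m
  obtain k where "g ` N' k (f x) \<subseteq> N'' m (g (f x))"
    using assms(2) unfolding nbhd_continuous_def by blast
  moreover obtain l where "f ` N l x \<subseteq> N' k (f x)"
    using assms(1) unfolding nbhd_continuous_def by blast
  ultimately show "\<exists>k. (\<lambda>x. g (f x)) ` N k x \<subseteq> N'' m (g (f x))"
    by blast
qed

lemma clopen_equiv_refl: "clopen_equiv N A A"
  unfolding clopen_equiv_def using nbhd_continuous_id by fastforce

lemma clopen_equiv_sym: "clopen_equiv N A B \<Longrightarrow> clopen_equiv N B A"
  unfolding clopen_equiv_def by blast

lemma clopen_equiv_trans:
  assumes "clopen_equiv N A B" "clopen_equiv N B C"
  shows "clopen_equiv N A C"
proof -
  obtain f g where fg: "nbhd_continuous N N f" "nbhd_continuous N N g"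
     "f ` A \<subseteq> B" "g ` B \<subseteq> A" "\<forall>x\<in>A. g (f x) = x" "\<forall>y\<in>B. f (g y) = y"
    using assms(1) unfolding clopen_equiv_def by blast
  obtain f' g' where fg': "nbhd_continuous N N f'" "nbhd_continuous N N g'"
     "f' ` B \<subseteq> C" "g' ` C \<subseteq> B" "\<forall>x\<in>B. g' (f' x) = x" "\<forall>y\<in>C. f' (g' y) = y"
    using assms(2) unfolding clopen_equiv_def by blast
  show ?thesis unfolding clopen_equiv_def
  proof (intro exI conjI)
    show "nbhd_continuous N N (\<lambda>x. f' (f x))" "nbhd_continuous N N (\<lambda>x. g (g' x))"
      using nbhd_continuous_compose fg fg' by blast+
  qed (use fg fg' in \<open>auto simp: image_subset_iff\<close>)
qed

context clopen_nbhds
begin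

lemma istopology_nbhd: "istopology (\<lambda>U. \<forall>x\<in>U. \<exists>m. N m x \<subseteq> U)"
  unfolding istopology_def
proof (intro conjI allI impI)
  fix S T assume S: "\<forall>x\<in>S. \<exists>m. N m x \<subseteq> S" and T: "\<forall>x\<in>T. \<exists>m. N m x \<subseteq> T"
  show "\<forall>x\<in>S \<inter> T. \<exists>m. N m x \<subseteq> S \<inter> T"
  proof
    fix x assume "x \<in> S \<inter> T"
    then obtain m k where "N m x \<subseteq> S" "N k x \<subseteq> T" using S T by blast
    moreover have "N (max m k) x \<subseteq> N m x" "N (max m k) x \<subseteq> N k x"
      by (simp_all add: nbhd_anti)
    ultimately show "\<exists>m. N m x \<subseteq> S \<inter> T" by blast
  qed
next
  fix \<K> assume "\<forall>K\<in>\<K>. \<forall>x\<in>K. \<exists>m. N m x \<subseteq> K"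
  then show "\<forall>x\<in>\<Union>\<K>. \<exists>m. N m x \<subseteq> \<Union>\<K>" by (meson Sup_upper UnionE subset_trans)
qed

lemma openin_nbhd: "openin (nbhd_topology N) U \<longleftrightarrow> (\<forall>x\<in>U. \<exists>m. N m x \<subseteq> U)"
  by (simp add: nbhd_topology_def istopology_nbhd)

lemma topspace_nbhd [simp]: "topspace (nbhd_topology N) = UNIV"
  using openin_nbhd[of UNIV] openin_subset by blast

lemma openin_nbhd_self: "openin (nbhd_topology N) (N m x)"
  using nbhd_open by (simp add: openin_nbhd)

lemma closedin_nbhd_self: "closedin (nbhd_topology N) (N m x)"
proof -
  have "openin (nbhd_topology N) (UNIV - N m x)"
    unfolding openin_nbhd using nbhd_closed by fast
  then show ?thesis by (simp add: closedin_def)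
qed

lemma continuous_map_nbhd:
  assumes "clopen_nbhds N'"
  shows "continuous_map (nbhd_topology N) (nbhd_topology N') f \<longleftrightarrow> nbhd_continuous N N' f"
proof -
  interpret N': clopen_nbhds N' by fact
  show ?thesis
  proof
    assume L: "continuous_map (nbhd_topology N) (nbhd_topology N') f"
    show "nbhd_continuous N N' f" unfolding nbhd_continuous_def
    proof (intro allI)
      fix x m
      have "openin (nbhd_topology N) {y \<in> topspace (nbhd_topology N). f y \<in> N' m (f x)}"
        using L N'.openin_nbhd_self openin_continuous_map_preimage by blast
      moreover have "x \<in> {y \<in> topspace (nbhd_topology N). f y \<in> N' m (f x)}"
        by (simp add: N'.nbhd_self)
      ultimately obtain k where "N k x \<subseteq> {y \<in> topspace (nbhd_topology N). f y \<in> N' m (f x)}"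
        unfolding openin_nbhd by blast
      then show "\<exists>k. f ` N k x \<subseteq> N' m (f x)" by blast
    qed
  next
    assume R: "nbhd_continuous N N' f"
    show "continuous_map (nbhd_topology N) (nbhd_topology N') f"
      unfolding continuous_map openin_nbhd N'.openin_nbhd
    proof (intro conjI allI impI ballI)
      fix U x assume "\<forall>x\<in>U. \<exists>m. N' m x \<subseteq> U" "x \<in> {x \<in> topspace (nbhd_topology N). f x \<in> U}"
      then obtain m where m: "N' m (f x) \<subseteq> U" by blast
      obtain k where "f ` N k x \<subseteq> N' m (f x)" using R unfolding nbhd_continuous_def by blast
      with m have "N k x \<subseteq> {x \<in> topspace (nbhd_topology N). f x \<in> U}" by auto
      then show "\<exists>k. N k x \<subseteq> {x \<in> topspace (nbhd_topology N). f x \<in> U}" by blast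
    qed simp
  qed
qed

lemma zero_dimensional_nbhd: "zero_dimensional (nbhd_topology N)"
  unfolding zero_dimensional_def
proof (intro allI impI)
  fix U x assume "openin (nbhd_topology N) U \<and> x \<in> U"
  then obtain m where "N m x \<subseteq> U" unfolding openin_nbhd by blast
  then show "\<exists>V. openin (nbhd_topology N) V \<and> closedin (nbhd_topology N) V \<and> x \<in> V \<and> V \<subseteq> U"
    by (intro exI[of _ "N m x"]) (simp add: openin_nbhd_self closedin_nbhd_self nbhd_self)
qed

lemma first_countable_nbhd: "first_countable (nbhd_topology N)"
  unfolding first_countable_def
proof
  fix x
  show "\<exists>\<B>. countable \<B> \<and> (\<forall>V\<in>\<B>. openin (nbhd_topology N) V) \<and>
             (\<forall>U. openin (nbhd_topology N) U \<and> x \<in> U \<longrightarrow> (\<exists>V\<in>\<B>. x \<in> V \<and> V \<subseteq> U))"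
  proof (intro exI[of _ "range (\<lambda>m. N m x)"] conjI allI impI)
    fix U assume "openin (nbhd_topology N) U \<and> x \<in> U"
    then obtain m where "N m x \<subseteq> U" unfolding openin_nbhd by blast
    then show "\<exists>V\<in>range (\<lambda>m. N m x). x \<in> V \<and> V \<subseteq> U" using nbhd_self by blast
  qed (auto simp: openin_nbhd_self)
qed

lemma Hausdorff_nbhd: "Hausdorff_space (nbhd_topology N)"
  unfolding Hausdorff_space_def
proof (intro allI impI)
  fix x y assume "x \<in> topspace (nbhd_topology N) \<and> y \<in> topspace (nbhd_topology N) \<and> x \<noteq> y"
  then obtain m where "y \<notin> N m x" using nbhd_sep by blast
  moreover obtain k where "N k y \<inter> N m x = {}"
    using \<open>y \<notin> N m x\<close> nbhd_closed by blast
  ultimately show "\<exists>U V. openin (nbhd_topology N) U \<and> openin (nbhd_topology N) V \<and>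
      x \<in> U \<and> y \<in> V \<and> disjnt U V"
    using openin_nbhd_self nbhd_self unfolding disjnt_def by (metis inf_commute)
qed

lemma hereditarily_separable_nbhd:
  assumes "\<And>A. \<exists>D\<subseteq>A. countable D \<and> (\<forall>a\<in>A. \<forall>m. D \<inter> N m a \<noteq> {})"
  shows "hereditarily_separable (nbhd_topology N)"
  unfolding hereditarily_separable_def
proof (intro allI impI)
  fix A
  obtain D where D: "D \<subseteq> A" "countable D" "\<And>a m. a \<in> A \<Longrightarrow> D \<inter> N m a \<noteq> {}"
    using assms[of A] by blast
  have "A \<subseteq> nbhd_topology N closure_of D"
  proof
    fix a assume "a \<in> A"
    with D(3) show "a \<in> nbhd_topology N closure_of D"
      unfolding in_closure_of openin_nbhd topspace_nbhd by blast
  qed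
  then show "separable_space (subtopology (nbhd_topology N) A)"
    unfolding separable_space_def using D(1,2)
    by (intro exI[of _ D]) (auto simp: closure_of_subtopology Int_absorb1)
qed

lemma clopen_set_nbhd: "clopen_set N (N m x)"
  unfolding clopen_set_def using nbhd_open nbhd_closed by blast

lemma clopen_set_UNIV: "clopen_set N UNIV"
  by (simp add: clopen_set_def)

lemma clopen_set_Diff:
  assumes "clopen_set N A" "clopen_set N B"
  shows "clopen_set N (A - B)"
  unfolding clopen_set_def
proof
  fix x
  obtain m k where "N m x \<subseteq> A \<or> N m x \<inter> A = {}" "N k x \<subseteq> B \<or> N k x \<inter> B = {}"
    using assms unfolding clopen_set_def by blast
  moreover have "N (max m k) x \<subseteq> N m x" "N (max m k) x \<subseteq> N k x"
    by (simp_all add: nbhd_anti)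
  ultimately show "\<exists>m. N m x \<subseteq> A - B \<or> N m x \<inter> (A - B) = {}" by blast
qed

lemma clopen_setD: "clopen_set N A \<Longrightarrow> x \<in> A \<Longrightarrow> \<exists>m. N m x \<subseteq> A"
  unfolding clopen_set_def using nbhd_self by fastforce

text \<open>Near each point membership in the clopen set is constant, so the case distinction agrees
  there with one of the two continuous maps.\<close>

lemma nbhd_continuous_if:
  assumes "clopen_set N A" "nbhd_continuous N N' f" "nbhd_continuous N N' g"
  shows "nbhd_continuous N N' (\<lambda>x. if x \<in> A then f x else g x)"
  unfolding nbhd_continuous_def
proof (intro allI)
  fix x m
  obtain k where k: "N k x \<subseteq> A \<or> N k x \<inter> A = {}" 
    using assms unfolding clopen_set_def by blast
  obtain a b where ab: "f ` N a x \<subseteq> N' m (f x)" "g ` N b x \<subseteq> N' m (g x)" 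
    using assms unfolding nbhd_continuous_def by meson
  define c where "c = max k (max a b)"
  have c: "N c x \<subseteq> N k x" "N c x \<subseteq> N a x" "N c x \<subseteq> N b x"
    by (rule nbhd_anti, simp add: c_def)+
  then have "f ` N c x \<subseteq> N' m (f x)" "g ` N c x \<subseteq> N' m (g x)"
    using ab by blast+
  with k c(1) have "(\<lambda>x. if x \<in> A then f x else g x) ` N c x \<subseteq> N' m (if x \<in> A then f x else g x)"
    using nbhd_self[of x k] by auto
  then show "\<exists>k. (\<lambda>x. if x \<in> A then f x else g x) ` N k x \<subseteq> N' m (if x \<in> A then f x else g x)"
    by blast
qed

text \<open>The maps are pasted by testing membership in \<open>A\<close> one way and in
  \<open>C\<close> the other way; disjointness makes each test recognise the right piece.\<close>

lemma clopen_equiv_Un: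
  assumes "clopen_equiv N A C" "clopen_equiv N B D" "clopen_set N A" "clopen_set N C"
    and "A \<inter> B = {}" "C \<inter> D = {}"
  shows "clopen_equiv N (A \<union> B) (C \<union> D)"
proof -
  obtain f g where fg: "nbhd_continuous N N f" "nbhd_continuous N N g"
     "f ` A \<subseteq> C" "g ` C \<subseteq> A" "\<forall>x\<in>A. g (f x) = x" "\<forall>y\<in>C. f (g y) = y"
    using assms(1) unfolding clopen_equiv_def by blast
  obtain f' g' where fg': "nbhd_continuous N N f'" "nbhd_continuous N N g'"
     "f' ` B \<subseteq> D" "g' ` D \<subseteq> B" "\<forall>x\<in>B. g' (f' x) = x" "\<forall>y\<in>D. f' (g' y) = y"
    using assms(2) unfolding clopen_equiv_def by blast
  let ?h = "\<lambda>x. if x \<in> A then f x else f' x" and ?k = "\<lambda>x. if x \<in> C then g x else g' x"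
  show ?thesis unfolding clopen_equiv_def
  proof (intro exI conjI)
    show "nbhd_continuous N N ?h" "nbhd_continuous N N ?k"
      using nbhd_continuous_if assms fg fg' by blast+
    have B: "x \<notin> A" if "x \<in> B" for x using assms(5) that by blast
    have D: "x \<notin> C" if "x \<in> D" for x using assms(6) that by blast
    show "?h ` (A \<union> B) \<subseteq> C \<union> D" using B fg fg' by (auto split: if_splits)
    show "?k ` (C \<union> D) \<subseteq> A \<union> B" using D fg fg' by (auto split: if_splits)
    show "\<forall>x\<in>A \<union> B. ?k (?h x) = x"
      using B D fg fg' by (auto simp: image_subset_iff)
    show "\<forall>x\<in>C \<union> D. ?h (?k x) = x"
      using B D fg fg' by (auto simp: image_subset_iff)
  qed
qed

lemma nbhd_avoid_finite: "finite F \<Longrightarrow> x \<notin> F \<Longrightarrow> \<exists>k. N k x \<inter> F = {}"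
proof (induction F rule: finite_induct)
  case (insert y F)
  then obtain k l where "N k x \<inter> F = {}" "y \<notin> N l x" using nbhd_sep by blast
  moreover have "N (max k l) x \<subseteq> N k x" "N (max k l) x \<subseteq> N l x" by (simp_all add: nbhd_anti)
  ultimately have "N (max k l) x \<inter> insert y F = {}" by blast
  then show ?case by blast
qed simp

section \<open>Countable powers of a space with a clopen base\<close>

lemma clopen_nbhds_power: "clopen_nbhds (power_nbhd N)"
proof
  fix x y :: "nat \<Rightarrow> 'a" and m k
  show "x \<in> power_nbhd N m x" by (simp add: power_nbhd_def nbhd_self)
  show "power_nbhd N k x \<subseteq> power_nbhd N m x" if "m \<le> k"
    using that nbhd_anti[OF that] by (fastforce simp: power_nbhd_def)
  show "\<exists>k. power_nbhd N k y \<subseteq> power_nbhd N m x" if "y \<in> power_nbhd N m x"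
  proof -
    have "\<exists>k. \<forall>i<m. N k (y i) \<subseteq> N m (x i)"
    proof (rule ex_uniform_bound)
      show "\<exists>k. N k (y i) \<subseteq> N m (x i)" if "i < m" for i
        using that \<open>y \<in> power_nbhd N m x\<close> nbhd_open by (simp add: power_nbhd_def)
    qed (use nbhd_anti in blast)
    then obtain k where "\<forall>i<m. N k (y i) \<subseteq> N m (x i)" by blast
    moreover have "N (max m k) (y i) \<subseteq> N k (y i)" for i by (simp add: nbhd_anti)
    ultimately have "power_nbhd N (max m k) y \<subseteq> power_nbhd N m x"
      unfolding power_nbhd_def by (smt (verit, ccfv_SIG) max.strict_coboundedI1 mem_Collect_eq subset_eq)
    then show ?thesis by blast
  qed
  show "\<exists>k. power_nbhd N k y \<inter> power_nbhd N m x = {}" if "y \<notin> power_nbhd N m x"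
  proof -
    from that obtain i where i: "i < m" "y i \<notin> N m (x i)" by (auto simp: power_nbhd_def)
    then obtain k where "N k (y i) \<inter> N m (x i) = {}" using nbhd_closed by blast
    moreover have "N (max (Suc i) k) (y i) \<subseteq> N k (y i)" by (simp add: nbhd_anti)
    moreover have "w i \<in> N (max (Suc i) k) (y i)" if "w \<in> power_nbhd N (max (Suc i) k) y" for w
      using that by (auto simp: power_nbhd_def)
    moreover have "w i \<in> N m (x i)" if "w \<in> power_nbhd N m x" for w
      using that i by (auto simp: power_nbhd_def)
    ultimately have "power_nbhd N (max (Suc i) k) y \<inter> power_nbhd N m x = {}"
      by blast
    then show ?thesis by blast
  qed
  show "\<exists>m. y \<notin> power_nbhd N m x" if "x \<noteq> y"
  proof -
    from that obtain i where "x i \<noteq> y i" by blast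
    then obtain m where "y i \<notin> N m (x i)" using nbhd_sep by blast
    moreover have "N (max (Suc i) m) (x i) \<subseteq> N m (x i)" by (simp add: nbhd_anti)
    ultimately have "y i \<notin> N (max (Suc i) m) (x i)" by blast
    then have "y \<notin> power_nbhd N (max (Suc i) m) x"
      unfolding power_nbhd_def using less_max_iff_disj by blast
    then show ?thesis by blast
  qed
qed

text \<open>An open box restricts finitely many coordinates, so one index beyond all of them and
  fine enough in each gives a basic set inside it; conversely each basic set is such a box.\<close>

lemma product_topology_nbhd: "product_topology (\<lambda>_::nat. nbhd_topology N) UNIV = nbhd_topology (power_nbhd N)"
proof -
  interpret P: clopen_nbhds "power_nbhd N" by (rule clopen_nbhds_power)
  have "openin (product_topology (\<lambda>_::nat. nbhd_topology N) UNIV) U \<longleftrightarrow>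
     openin (nbhd_topology (power_nbhd N)) U" for U
  proof
    assume L: "openin (product_topology (\<lambda>_::nat. nbhd_topology N) UNIV) U"
    show "openin (nbhd_topology (power_nbhd N)) U" unfolding P.openin_nbhd
    proof
      fix x assume "x \<in> U"
      from product_topology_open_contains_basis[OF L this]
      obtain B where B: "x \<in> (\<Pi>\<^sub>E i\<in>UNIV. B i)" "\<forall>i. openin (nbhd_topology N) (B i)"
         "finite {i. B i \<noteq> UNIV}" "(\<Pi>\<^sub>E i\<in>UNIV. B i) \<subseteq> U" by auto
      obtain n where n: "\<And>i. B i \<noteq> UNIV \<Longrightarrow> i < n"
        using B(3) finite_nat_set_iff_bounded by auto
      have "\<exists>k. \<forall>i<n. N k (x i) \<subseteq> B i"
      proof (rule ex_uniform_bound)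
        show "\<exists>k. N k (x i) \<subseteq> B i" for i
          using B(1,2) unfolding openin_nbhd by (simp add: PiE_iff)
      qed (use nbhd_anti in blast)
      then obtain k where k: "\<forall>i<n. N k (x i) \<subseteq> B i" by blast
      have "power_nbhd N (max n k) x \<subseteq> (\<Pi>\<^sub>E i\<in>UNIV. B i)"
      proof
        fix w assume w: "w \<in> power_nbhd N (max n k) x"
        have "w i \<in> B i" for i
        proof (cases "i < n")
          case True
          then have "w i \<in> N (max n k) (x i)" using w by (simp add: power_nbhd_def)
          then show ?thesis using k True nbhd_anti[of k "max n k" "x i"] by auto
        qed (use n in blast)
        then show "w \<in> (\<Pi>\<^sub>E i\<in>UNIV. B i)" by auto
      qed
      with B(4) show "\<exists>m. power_nbhd N m x \<subseteq> U" by blast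
    qed
  next
    assume R: "openin (nbhd_topology (power_nbhd N)) U"
    show "openin (product_topology (\<lambda>_::nat. nbhd_topology N) UNIV) U"
    proof (subst openin_subopen, intro ballI)
      fix x assume "x \<in> U"
      then obtain m where m: "power_nbhd N m x \<subseteq> U" using R unfolding P.openin_nbhd by blast
      have eq: "power_nbhd N m x = (\<Pi>\<^sub>E i\<in>UNIV. if i < m then N m (x i) else UNIV)"
        by (auto simp: power_nbhd_def PiE_iff split: if_splits)
      have "openin (product_topology (\<lambda>_::nat. nbhd_topology N) UNIV) (power_nbhd N m x)"
        unfolding eq
      proof (rule product_topology_basis)
        show "openin (nbhd_topology N) (if i < m then N m (x i) else UNIV)" for i
          using openin_nbhd_self openin_topspace[of "nbhd_topology N"] by simp
        show "finite {i. (if i < m then N m (x i) else UNIV) \<noteq> topspace (nbhd_topology N)}"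
          by (rule finite_subset[of _ "{..<m}"]) auto
      qed
      then show "\<exists>T. openin (product_topology (\<lambda>_::nat. nbhd_topology N) UNIV) T \<and> x \<in> T \<and> T \<subseteq> U"
        using m P.nbhd_self by blast
    qed
  qed
  then show ?thesis by (simp add: topology_eq)
qed

text \<open>Covers the maps needed later: deleting, inserting, shifting or altering coordinates
  makes each output coordinate a continuous function of one input coordinate.\<close>

lemma nbhd_continuous_power:
  assumes "\<And>i. \<exists>j u. nbhd_continuous N N u \<and> (\<forall>z. h z i = u (z j))"
  shows "nbhd_continuous (power_nbhd N) (power_nbhd N) h"
  unfolding nbhd_continuous_def
proof (intro allI)
  fix x m
  interpret P: clopen_nbhds "power_nbhd N" by (rule clopen_nbhds_power)
  have "\<exists>k. \<forall>i<m. \<forall>z\<in>power_nbhd N k x. h z i \<in> N m (h x i)"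
  proof (rule ex_uniform_bound)
    fix i
    obtain j u where ju: "nbhd_continuous N N u" "\<And>z. h z i = u (z j)" using assms by blast
    obtain k where k: "u ` N k (x j) \<subseteq> N m (u (x j))" using ju unfolding nbhd_continuous_def by blast
    have "\<forall>z\<in>power_nbhd N (max k (Suc j)) x. h z i \<in> N m (h x i)"
    proof
      fix z assume "z \<in> power_nbhd N (max k (Suc j)) x"
      then have "z j \<in> N (max k (Suc j)) (x j)" by (simp add: power_nbhd_def)
      then have "z j \<in> N k (x j)" using nbhd_anti[of k "max k (Suc j)"] by auto
      then show "h z i \<in> N m (h x i)" using k ju by auto
    qed
    then show "\<exists>k. \<forall>z\<in>power_nbhd N k x. h z i \<in> N m (h x i)" by blast
  qed (use P.nbhd_anti in blast)
  then show "\<exists>k. h ` power_nbhd N k x \<subseteq> power_nbhd N m (h x)"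
    by (auto simp: power_nbhd_def image_subset_iff)
qed

end

section \<open>Homogeneity of the countable power\<close>

text \<open>Compactness will give clopen sets of the power finite support, isolated points will
  split them, and a non-isolated point provides a convergent sequence along which to shift.\<close>

locale compact_clopen_nbhds = clopen_nbhds +
  assumes compact_nbhd: "compact_space (nbhd_topology N)"
    and isolated_dense: "\<exists>p\<in>N m x. \<exists>k. N k p = {p}"
    and not_discrete: "\<exists>x. \<forall>m. N m x \<noteq> {x}"
begin

lemma power_compact: "compact_space (nbhd_topology (power_nbhd N))"
  unfolding product_topology_nbhd[symmetric] by (simp add: compact_space_product_topology compact_nbhd)

lemma isolated_sequence:
  obtains q and f :: "nat \<Rightarrow> 'a"
  where "inj f" "\<forall>n. f n \<in> N n q" "\<forall>n. f n \<noteq> q" "\<forall>n. \<exists>k. N k (f n) = {f n}"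
proof -
  obtain q where q: "\<And>m. N m q \<noteq> {q}" using not_discrete by blast
  \<comment> \<open>A state is an isolated point with the index of the neighbourhood of
    \<open>q\<close> it comes from; \<open>Q\<close> makes the next neighbourhood exclude that
    point, which forces injectivity.\<close>
  define P where "P = (\<lambda>n (s :: 'a \<times> nat). n \<le> snd s \<and> fst s \<in> N (snd s) q \<and> (\<exists>k. N k (fst s) = {fst s}))"
  define Q where "Q = (\<lambda>(n::nat) (s :: 'a \<times> nat) (s' :: 'a \<times> nat).
      snd s \<le> snd s' \<and> fst s \<notin> N (snd s') q)"
  have "\<exists>s. \<forall>n. P n (s n) \<and> Q n (s n) (s (Suc n))"
  proof (rule dependent_nat_choice)
    show "\<exists>s. P 0 s" using isolated_dense[of 0 q] by (auto simp: P_def)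
    fix s n assume P: "P n s"
    then have "fst s \<noteq> q" using q by (auto simp: P_def)
    then obtain m where m: "fst s \<notin> N m q" using nbhd_sep by metis
    define m' where "m' = max m (Suc (snd s))"
    obtain p where "p \<in> N m' q" "\<exists>k. N k p = {p}" using isolated_dense by blast
    moreover have "fst s \<notin> N m' q" using m nbhd_anti[of m m' q] by (auto simp: m'_def)
    ultimately show "\<exists>s'. P (Suc n) s' \<and> Q n s s'"
      using P by (intro exI[of _ "(p, m')"]) (auto simp: P_def Q_def m'_def)
  qed
  then obtain s where s: "\<And>n. P n (s n)" "\<And>n. Q n (s n) (s (Suc n))" by blast
  have mono: "snd (s i) \<le> snd (s j)" if "i \<le> j" for i j
    using that by (rule lift_Suc_mono_le[rotated]) (use s in \<open>auto simp: Q_def\<close>)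
  have ne: "fst (s i) \<noteq> fst (s j)" if "i < j" for i j
  proof -
    have "N (snd (s j)) q \<subseteq> N (snd (s (Suc i))) q"
      using that by (intro nbhd_anti mono) simp
    then show ?thesis using s(2)[of i] s(1)[of j] by (auto simp: P_def Q_def)
  qed
  have iso: "\<exists>k. N k (fst (s n)) = {fst (s n)}" for n using s(1)[of n] by (auto simp: P_def)
  show thesis
  proof
    show "inj (\<lambda>n. fst (s n))"
      by (rule injI) (metis ne linorder_neqE_nat)
    show "\<forall>n. fst (s n) \<in> N n q"
    proof
      fix n show "fst (s n) \<in> N n q"
        using s(1)[of n] nbhd_anti[of n "snd (s n)" q] by (auto simp: P_def)
    qed
    show "\<forall>n. \<exists>k. N k (fst (s n)) = {fst (s n)}" using iso by blast
    show "\<forall>n. fst (s n) \<noteq> q" using iso q by metis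
  qed
qed

text \<open>Moving along a sequence of isolated points that converges to \<open>q\<close> shifts one of them away.\<close>

lemma remove_isolated_point:
  obtains p g g' where "\<exists>k. N k p = {p}" "nbhd_continuous N N g" "nbhd_continuous N N g'"
    "\<forall>x. g x \<noteq> p" "\<forall>x. g' (g x) = x" "\<forall>x. x \<noteq> p \<longrightarrow> g (g' x) = x"
proof -
  obtain q and f :: "nat \<Rightarrow> 'a" where f': "inj f" "\<forall>n. f n \<in> N n q" "\<forall>n. f n \<noteq> q"
      "\<forall>n. \<exists>k. N k (f n) = {f n}"
    by (rule isolated_sequence)
  then have f: "inj f" "\<And>n. f n \<in> N n q" "\<And>n. f n \<noteq> q" "\<And>n. \<exists>k. N k (f n) = {f n}"
    by blast+
  \<comment> \<open>\<open>h \<sigma>\<close> reindexes the sequence by \<open>\<sigma>\<close> and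
    fixes all other points.\<close>
  define h where "h = (\<lambda>\<sigma> x. if x \<in> range f then f (\<sigma> (inv f x)) else x)"
  have h_f: "h \<sigma> (f n) = f (\<sigma> n)" for \<sigma> n using f(1) by (simp add: h_def)
  have h_else: "h \<sigma> x = x" if "x \<notin> range f" for \<sigma> x using that by (simp add: h_def)
  have q: "q \<notin> range f" using f(3) by blast
  \<comment> \<open>The bound makes \<open>\<sigma>\<close> tend to infinity, which is continuity at
    \<open>q\<close>; it holds for the successor and for the predecessor.\<close>
  have cont: "nbhd_continuous N N (h \<sigma>)" if \<sigma>: "\<And>n. n \<le> Suc (\<sigma> n)" for \<sigma>
    unfolding nbhd_continuous_def
  proof (intro allI)
    fix x m
    consider n where "x = f n" | "x = q" | "x \<notin> range f" "x \<noteq> q" by blast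
    then show "\<exists>k. h \<sigma> ` N k x \<subseteq> N m (h \<sigma> x)"
    proof cases
      case 1
      then obtain k where "N k x = {x}" using f(4) by blast
      then show ?thesis using nbhd_self by (intro exI[of _ k]) auto
    next
      case 2
      have "finite (f ` {..m})" "q \<notin> f ` {..m}" using q by auto
      then obtain k where k: "N k q \<inter> f ` {..m} = {}" using nbhd_avoid_finite by blast
      have "h \<sigma> y \<in> N m q" if y: "y \<in> N (max k m) q" for y
      proof (cases "y \<in> range f")
        case True
        then obtain n where n: "y = f n" by blast
        have "y \<in> N k q" using y nbhd_anti[of k "max k m" q] by auto
        then have "\<not> n \<le> m" using k n by auto
        then have "m \<le> \<sigma> n" using \<sigma>[of n] by linarith
        then show ?thesis using f(2)[of "\<sigma> n"] nbhd_anti[of m "\<sigma> n" q] n by (auto simp: h_f)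
      next
        case False
        then show ?thesis using y nbhd_anti[of m "max k m" q] by (auto simp: h_else)
      qed
      then show ?thesis using 2 h_else[OF q] by (intro exI[of _ "max k m"]) auto
    next
      case 3
      \<comment> \<open>The sequence eventually lies in a neighbourhood of \<open>q\<close> disjoint
        from \<open>N l x\<close>, so a small neighbourhood of \<open>x\<close> meets no term and is
        fixed pointwise.\<close>
      then obtain l where l: "q \<notin> N l x" using nbhd_sep by metis
      then obtain j where j: "N j q \<inter> N l x = {}" using nbhd_closed by blast
      have "finite (f ` {..<j})" "x \<notin> f ` {..<j}" using 3 by auto
      then obtain k where k: "N k x \<inter> f ` {..<j} = {}" using nbhd_avoid_finite by blast
      have "h \<sigma> y = y \<and> y \<in> N m x" if y: "y \<in> N (max m (max k l)) x" for y
      proof -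
        have y': "y \<in> N m x" "y \<in> N k x" "y \<in> N l x"
          using y by (rule subsetD[OF nbhd_anti, rotated]; simp)+
        have "y \<noteq> f n" for n
        proof (cases "n < j")
          case False
          then have "f n \<in> N j q" using f(2)[of n] nbhd_anti[of j n q] by auto
          then show ?thesis using j y' by blast
        qed (use k y' in auto)
        then show ?thesis using y' h_else by blast
      qed
      then show ?thesis using 3 h_else[of x] by (intro exI[of _ "max m (max k l)"]) auto
    qed
  qed
  show thesis
  proof
    show "\<exists>k. N k (f 0) = {f 0}" by (rule f)
    show "nbhd_continuous N N (h Suc)" "nbhd_continuous N N (h (\<lambda>n. n - 1))"
      by (rule cont, simp)+
    show "\<forall>x. h Suc x \<noteq> f 0"
    proof
      fix x show "h Suc x \<noteq> f 0"
        using f(1) by (cases "x \<in> range f") (auto simp: h_f h_else inj_eq)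
    qed
    show "\<forall>x. h (\<lambda>n. n - 1) (h Suc x) = x"
    proof
      fix x show "h (\<lambda>n. n - 1) (h Suc x) = x"
        by (cases "x \<in> range f") (auto simp: h_f h_else)
    qed
    show "\<forall>x. x \<noteq> f 0 \<longrightarrow> h Suc (h (\<lambda>n. n - 1) x) = x"
    proof (intro allI impI)
      fix x assume "x \<noteq> f 0"
      show "h Suc (h (\<lambda>n. n - 1) x) = x"
      proof (cases "x \<in> range f")
        case True
        then obtain n where "x = f n" by blast
        with \<open>x \<noteq> f 0\<close> have "n > 0" by (cases n) auto
        then show ?thesis using \<open>x = f n\<close> by (simp add: h_f)
      qed (simp add: h_else)
    qed
  qed
qed

section \<open>Nonempty clopen subsets of the countable power\<close>

lemma clopen_finite_support:
  assumes "clopen_set (power_nbhd N) A"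
  shows "\<exists>n. \<forall>z w. z \<in> A \<longrightarrow> (\<forall>i<n. w i = z i) \<longrightarrow> w \<in> A"
proof -
  interpret P: clopen_nbhds "power_nbhd N" by (rule clopen_nbhds_power)
  let ?Z = "nbhd_topology (power_nbhd N)"
  have "openin ?Z (- A)" unfolding P.openin_nbhd
    using assms P.nbhd_self unfolding clopen_set_def by blast
  then have "closedin ?Z A" by (simp add: closedin_def Compl_eq_Diff_UNIV)
  \<comment> \<open>By compactness finitely many basic sets make up \<open>A\<close>, and each of
    them restricts only finitely many coordinates.\<close>
  then have "compactin ?Z A" using power_compact closedin_compact_space by blast
  define \<U> where "\<U> = {power_nbhd N m z |m z. power_nbhd N m z \<subseteq> A}"
  have "A \<subseteq> \<Union>\<U>"
  proof
    fix z assume "z \<in> A"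
    then obtain m where "power_nbhd N m z \<subseteq> A" using P.clopen_setD assms by blast
    then show "z \<in> \<Union>\<U>" using P.nbhd_self[of z m] unfolding \<U>_def by blast
  qed
  moreover have "openin ?Z U" if "U \<in> \<U>" for U
    using that P.openin_nbhd_self unfolding \<U>_def by blast
  ultimately obtain \<F> where \<F>: "finite \<F>" "\<F> \<subseteq> \<U>" "A \<subseteq> \<Union>\<F>"
    using \<open>compactin ?Z A\<close> unfolding compactin_def by meson
  have "\<exists>n. \<forall>U\<in>\<F>. \<forall>z w. z \<in> U \<longrightarrow> (\<forall>i<n. w i = z i) \<longrightarrow> w \<in> U"
    using \<F>(1,2)
  proof (induction \<F> rule: finite_induct)
    case (insert U \<F>)
    then obtain n where n: "\<forall>U\<in>\<F>. \<forall>z w. z \<in> U \<longrightarrow> (\<forall>i<n. w i = z i) \<longrightarrow> w \<in> U" by auto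
    obtain m y where "U = power_nbhd N m y" using insert.prems unfolding \<U>_def by blast
    then have "\<forall>z w. z \<in> U \<longrightarrow> (\<forall>i<m. w i = z i) \<longrightarrow> w \<in> U" by (simp add: power_nbhd_def)
    with n show ?case
      by (intro exI[of _ "max n m"]) (metis insert_iff less_max_iff_disj)
  qed simp
  then obtain n where n: "\<forall>U\<in>\<F>. \<forall>z w. z \<in> U \<longrightarrow> (\<forall>i<n. w i = z i) \<longrightarrow> w \<in> U" ..
  have sub: "\<Union>\<F> \<subseteq> A" using \<F>(2) unfolding \<U>_def by blast
  show ?thesis
  proof (intro exI[of _ n] allI impI)
    fix z w assume "z \<in> A" and w: "\<forall>i<n. w i = z i"
    then obtain U where "U \<in> \<F>" "z \<in> U" using \<F>(3) by blast
    with n w have "w \<in> U" by blast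
    with sub \<open>U \<in> \<F>\<close> show "w \<in> A" by blast
  qed
qed

text \<open>Isolated points at coordinate \<open>n\<close> split \<open>A\<close>: the part with \<open>z n = p\<close> is \<open>A\<close> again by deleting this
  coordinate, the rest by moving the coordinate into the complement of \<open>p\<close>.\<close>

lemma clopen_halves:
  assumes "clopen_set (power_nbhd N) A"
  obtains B where "B \<subseteq> A" "clopen_set (power_nbhd N) B"
    "clopen_equiv (power_nbhd N) B A" "clopen_equiv (power_nbhd N) (A - B) A"
proof -
  interpret P: clopen_nbhds "power_nbhd N" by (rule clopen_nbhds_power)
  obtain n where n: "\<And>z w. z \<in> A \<Longrightarrow> \<forall>i<n. w i = z i \<Longrightarrow> w \<in> A"
    using clopen_finite_support[OF assms] by blast
  obtain p g g' where p: "\<exists>k. N k p = {p}" and g: "nbhd_continuous N N g" "nbhd_continuous N N g'"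
    "\<forall>x. g x \<noteq> p" "\<forall>x. g' (g x) = x" "\<forall>x. x \<noteq> p \<longrightarrow> g (g' x) = x"
    by (rule remove_isolated_point)
  define B where "B = A \<inter> {z. z n = p}"
  have "clopen_set (power_nbhd N) (- {z. z n = p})"
    unfolding clopen_set_def
  proof
    fix z
    obtain k where k: "N k (z n) \<subseteq> {p} \<or> p \<notin> N k (z n)"
      using p nbhd_sep by (cases "z n = p") (auto, metis)
    have "w n \<in> N k (z n)" if "w \<in> power_nbhd N (max k (Suc n)) z" for w
      using that nbhd_anti[of k "max k (Suc n)" "z n"] by (auto simp: power_nbhd_def)
    with k show "\<exists>m. power_nbhd N m z \<subseteq> - {z. z n = p} \<or> power_nbhd N m z \<inter> - {z. z n = p} = {}"
      by (intro exI[of _ "max k (Suc n)"]) blast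
  qed
  then have "clopen_set (power_nbhd N) (A - - {z. z n = p})" using P.clopen_set_Diff assms by blast
  then have B: "clopen_set (power_nbhd N) B" by (simp add: B_def Diff_eq)
  show thesis
  proof
    show "B \<subseteq> A" by (simp add: B_def)
    show "clopen_set (power_nbhd N) B" by (rule B)
    \<comment> \<open>\<open>?d\<close> deletes coordinate \<open>n\<close> and \<open>?e\<close>
      inserts \<open>p\<close> there; both keep the first \<open>n\<close> coordinates, which decide
      membership in \<open>A\<close>.\<close>
    let ?d = "\<lambda>(z::nat \<Rightarrow> 'a) i. if i < n then z i else z (Suc i)"
    let ?e = "\<lambda>z i. if i < n then z i else if i = n then p else z (i - 1)"
    show "clopen_equiv (power_nbhd N) B A" unfolding clopen_equiv_def
    proof (intro exI conjI)
      show "nbhd_continuous (power_nbhd N) (power_nbhd N) ?d"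
      proof (rule nbhd_continuous_power)
        fix i show "\<exists>j u. nbhd_continuous N N u \<and> (\<forall>z. ?d z i = u (z j))"
          using nbhd_continuous_id
          by (intro exI[of _ "if i < n then i else Suc i"] exI[of _ "\<lambda>x. x"]) auto
      qed
      show "nbhd_continuous (power_nbhd N) (power_nbhd N) ?e"
      proof (rule nbhd_continuous_power)
        fix i show "\<exists>j u. nbhd_continuous N N u \<and> (\<forall>z. ?e z i = u (z j))"
        proof (cases "i = n")
          case True
          have "nbhd_continuous N N (\<lambda>_. p)" by (rule nbhd_continuous_const) (rule nbhd_self)
          with True show ?thesis by (intro exI[of _ i] exI[of _ "\<lambda>_. p"]) auto
        next
          case False
          then show ?thesis using nbhd_continuous_id
            by (intro exI[of _ "if i < n then i else i - 1"] exI[of _ "\<lambda>x. x"]) auto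
        qed
      qed
      show "?d ` B \<subseteq> A"
      proof clarify
        fix z assume "z \<in> B" then show "?d z \<in> A" using n[of z "?d z"] by (auto simp: B_def)
      qed
      show "?e ` A \<subseteq> B"
      proof clarify
        fix z assume "z \<in> A" then show "?e z \<in> B" using n[of z "?e z"] by (auto simp: B_def)
      qed
      show "\<forall>z\<in>B. ?e (?d z) = z" by (auto simp: B_def fun_eq_iff)
      show "\<forall>z\<in>A. ?d (?e z) = z" by (auto simp: fun_eq_iff)
    qed
    let ?g = "\<lambda>z. z(n := g (z n))" and ?g' = "\<lambda>z. z(n := g' (z n))"
    have c: "nbhd_continuous (power_nbhd N) (power_nbhd N) (\<lambda>z. z(n := u (z n)))"
      if "nbhd_continuous N N u" for u
    proof (rule nbhd_continuous_power)
      fix i show "\<exists>j v. nbhd_continuous N N v \<and> (\<forall>z. (z(n := u (z n))) i = v (z j))"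
        using that nbhd_continuous_id by (intro exI[of _ i] exI[of _ "if i = n then u else (\<lambda>x. x)"]) auto
    qed
    show "clopen_equiv (power_nbhd N) (A - B) A" unfolding clopen_equiv_def
    proof (intro exI conjI)
      show "nbhd_continuous (power_nbhd N) (power_nbhd N) ?g'"
           "nbhd_continuous (power_nbhd N) (power_nbhd N) ?g" using c g by blast+
      show "?g' ` (A - B) \<subseteq> A"
      proof clarify
        fix z assume "z \<in> A" then show "?g' z \<in> A" using n[of z "?g' z"] by auto
      qed
      show "?g ` A \<subseteq> A - B"
      proof clarify
        fix z assume "z \<in> A" then show "?g z \<in> A - B" using n[of z "?g z"] g(3) by (auto simp: B_def)
      qed
      show "\<forall>z\<in>A - B. ?g (?g' z) = z" using g by (auto simp: B_def)
      show "\<forall>z\<in>A. ?g' (?g z) = z" using g by auto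
    qed
  qed
qed

text \<open>Fixing finitely many coordinates at isolated points inside a basic subset of
  \<open>A\<close> leaves a clopen set, and shifting the remaining coordinates identifies it with
  the whole power.\<close>

lemma clopen_contains_copy:
  assumes "clopen_set (power_nbhd N) A" "A \<noteq> {}"
  obtains B where "B \<subseteq> A" "clopen_set (power_nbhd N) B" "clopen_equiv (power_nbhd N) B UNIV"
proof -
  interpret P: clopen_nbhds "power_nbhd N" by (rule clopen_nbhds_power)
  obtain z m where z: "power_nbhd N m z \<subseteq> A" using assms P.clopen_setD by blast
  have "\<forall>i. \<exists>p. p \<in> N m (z i) \<and> (\<exists>k. N k p = {p})"
    using isolated_dense by blast
  then obtain p where p: "\<And>i. p i \<in> N m (z i)" "\<And>i. \<exists>k. N k (p i) = {p i}"
    by metis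
  define B where "B = {w. \<forall>i<m. w i = p i}"
  show thesis
  proof
    show "B \<subseteq> A" using z p(1) by (auto simp: B_def power_nbhd_def)
    have "\<exists>k. \<forall>i<m. N k (p i) = {p i}"
    proof (rule ex_uniform_bound)
      show "N k' (p i) = {p i}" if "N k (p i) = {p i}" "k \<le> k'" for i k k'
        using nbhd_anti[OF that(2), of "p i"] nbhd_self[of "p i" k'] that by auto
    qed (rule p)
    then obtain k where k: "\<forall>i<m. N k (p i) = {p i}" by blast
    have B_power: "power_nbhd N (max m k) w \<subseteq> B" if "w \<in> B" for w
    proof
      fix v assume v: "v \<in> power_nbhd N (max m k) w"
      show "v \<in> B" unfolding B_def
      proof (clarify)
        fix i assume "i < m"
        then have "v i \<in> N (max m k) (w i)"
          using v by (simp add: power_nbhd_def)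
        moreover have "w i = p i" using that \<open>i < m\<close> by (simp add: B_def)
        ultimately have "v i \<in> N (max m k) (p i)" by simp
        then show "v i = p i" using k \<open>i < m\<close> nbhd_anti[of k "max m k" "p i"] by auto
      qed
    qed
    show "clopen_set (power_nbhd N) B" unfolding clopen_set_def
    proof
      fix w
      show "\<exists>n. power_nbhd N n w \<subseteq> B \<or> power_nbhd N n w \<inter> B = {}"
      proof (cases "w \<in> B")
        case False
        then obtain i where i: "i < m" "w i \<noteq> p i" by (auto simp: B_def)
        then obtain l where "p i \<notin> N l (w i)" using nbhd_sep by metis
        then have "p i \<notin> N (max l m) (w i)" using nbhd_anti[of l "max l m" "w i"] by auto
        moreover have "v i \<in> N (max l m) (w i)" if "v \<in> power_nbhd N (max l m) w" for v
          using that i(1) by (simp add: power_nbhd_def)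
        moreover have "v i = p i" if "v \<in> B" for v
          using that i(1) by (simp add: B_def)
        ultimately have "power_nbhd N (max l m) w \<inter> B = {}" by (metis disjoint_iff)
        then show ?thesis by blast
      qed (use B_power in blast)
    qed
    let ?d = "\<lambda>(z::nat \<Rightarrow> 'a) i. z (i + m)" and ?e = "\<lambda>z i. if i < m then p i else z (i - m)"
    show "clopen_equiv (power_nbhd N) B UNIV" unfolding clopen_equiv_def
    proof (intro exI conjI)
      show "nbhd_continuous (power_nbhd N) (power_nbhd N) ?d"
      proof (rule nbhd_continuous_power)
        fix i show "\<exists>j u. nbhd_continuous N N u \<and> (\<forall>z. ?d z i = u (z j))"
          using nbhd_continuous_id by (intro exI[of _ "i + m"] exI[of _ "\<lambda>x. x"]) auto
      qed
      show "nbhd_continuous (power_nbhd N) (power_nbhd N) ?e"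
      proof (rule nbhd_continuous_power)
        fix i show "\<exists>j u. nbhd_continuous N N u \<and> (\<forall>z. ?e z i = u (z j))"
        proof (cases "i < m")
          case True
          have "nbhd_continuous N N (\<lambda>_. p i)" by (rule nbhd_continuous_const) (rule nbhd_self)
          with True show ?thesis by (intro exI[of _ i] exI[of _ "\<lambda>_. p i"]) auto
        next
          case False
          then show ?thesis using nbhd_continuous_id
            by (intro exI[of _ "i - m"] exI[of _ "\<lambda>x. x"]) auto
        qed
      qed
    qed (auto simp: B_def fun_eq_iff)
  qed
qed

text \<open>A decomposition argument in the style of Cantor-Bernstein. \<open>B1\<close> is a copy
  of the whole power inside \<open>A\<close> with \<open>A - B1\<close> equivalent to
  \<open>A\<close>, while \<open>A1\<close> is a copy of \<open>A\<close> with complement equivalent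
  to the whole power. Matching \<open>B1\<close> with the complement of \<open>A1\<close>, and
  \<open>A - B1\<close> with \<open>A1\<close>, gives the claim.\<close>

lemma clopen_equiv_whole:
  assumes "clopen_set (power_nbhd N) A" "A \<noteq> {}"
  shows "clopen_equiv (power_nbhd N) A UNIV"
proof -
  interpret P: clopen_nbhds "power_nbhd N" by (rule clopen_nbhds_power)
  let ?E = "clopen_equiv (power_nbhd N)"
  obtain B where B: "B \<subseteq> A" "clopen_set (power_nbhd N) B" "?E B UNIV"
    by (rule clopen_contains_copy[OF assms])
  obtain B1 where B1: "B1 \<subseteq> B" "clopen_set (power_nbhd N) B1" "?E B1 B" "?E (B - B1) B"
    by (rule clopen_halves[OF B(2)])
  obtain A1 where A1: "A1 \<subseteq> A" "clopen_set (power_nbhd N) A1" "?E A1 A" "?E (A - A1) A"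
    by (rule clopen_halves[OF assms(1)])
  \<comment> \<open>Replacing \<open>B\<close> by its other half while fixing \<open>A - B\<close>
    shows that removing \<open>B1\<close> does not change \<open>A\<close>.\<close>
  have B1A: "?E ((B - B1) \<union> (A - B)) (B \<union> (A - B))"
    using B1 B assms P.clopen_set_Diff
    by (intro P.clopen_equiv_Un clopen_equiv_refl) auto
  have "(B - B1) \<union> (A - B) = A - B1" "B \<union> (A - B) = A" using B(1) B1(1) by auto
  with B1A have AB1: "?E (A - B1) A" by simp
  have "?E ((A - A1) \<union> (UNIV - A)) (A \<union> (UNIV - A))"
    using A1 assms P.clopen_set_Diff
    by (intro P.clopen_equiv_Un clopen_equiv_refl) auto
  moreover have "(A - A1) \<union> (UNIV - A) = UNIV - A1" "A \<union> (UNIV - A) = UNIV"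
    using A1(1) by auto
  ultimately have UA1: "?E (UNIV - A1) UNIV" by simp
  have "?E (B1 \<union> (A - B1)) ((UNIV - A1) \<union> A1)"
  proof (rule P.clopen_equiv_Un)
    show "?E B1 (UNIV - A1)"
      using B1(3) B(3) UA1 clopen_equiv_trans clopen_equiv_sym by blast
    show "?E (A - B1) A1" using AB1 A1(3) clopen_equiv_trans clopen_equiv_sym by blast
  qed (use B1 A1 P.clopen_set_Diff P.clopen_set_UNIV in auto)
  moreover have "B1 \<union> (A - B1) = A" "(UNIV - A1) \<union> A1 = UNIV" using B1(1) B(1) by auto
  ultimately show ?thesis by simp
qed

text \<open>Coordinate \<open>m\<close> is unrestricted and can be altered, because an isolated and
  a non-isolated point give two distinct values.\<close>

lemma power_no_isolated: "power_nbhd N m z \<noteq> {z}"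
proof
  assume eq: "power_nbhd N m z = {z}"
  obtain q where q: "\<And>m. N m q \<noteq> {q}" using not_discrete by blast
  obtain p k where "N k p = {p}" using isolated_dense by blast
  then have "p \<noteq> q" using q by blast
  then obtain r where "r \<noteq> z m" by metis
  then have "z(m := r) \<noteq> z" by (metis fun_upd_same)
  moreover have "z(m := r) \<in> power_nbhd N m z" by (simp add: power_nbhd_def nbhd_self)
  ultimately show False using eq by blast
qed

text \<open>Strict inclusion is available because no point is isolated; it makes every ring
  \<open>U n - U (Suc n)\<close> nonempty.\<close>

lemma power_shrinking_base:
  fixes x :: "nat \<Rightarrow> 'a"
  shows "\<exists>U. U 0 = UNIV \<and> (\<forall>n. clopen_set (power_nbhd N) (U n) \<and> x \<in> U n \<and>
    U (Suc n) \<subset> U n \<and> U (Suc n) \<subseteq> power_nbhd N n x)"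
proof -
  interpret P: clopen_nbhds "power_nbhd N" by (rule clopen_nbhds_power)
  have "\<exists>U. \<forall>n. (clopen_set (power_nbhd N) (U n) \<and> x \<in> U n \<and> (n = 0 \<longrightarrow> U n = UNIV)) \<and>
      (U (Suc n) \<subset> U n \<and> U (Suc n) \<subseteq> power_nbhd N n x)"
  proof (rule dependent_nat_choice)
    fix U and n :: nat assume U: "clopen_set (power_nbhd N) U \<and> x \<in> U \<and> (n = 0 \<longrightarrow> U = UNIV)"
    then obtain m where m: "power_nbhd N m x \<subseteq> U" using P.clopen_setD by blast
    obtain z where "z \<in> power_nbhd N m x" "x \<noteq> z" using power_no_isolated P.nbhd_self by blast
    then obtain l where l: "z \<notin> power_nbhd N l x" using P.nbhd_sep by metis
    let ?k = "max n (max m l)"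
    have "power_nbhd N ?k x \<subseteq> power_nbhd N n x" "power_nbhd N ?k x \<subseteq> power_nbhd N m x"
         "power_nbhd N ?k x \<subseteq> power_nbhd N l x"
      by (rule P.nbhd_anti, simp)+
    then have "power_nbhd N ?k x \<subset> U \<and> power_nbhd N ?k x \<subseteq> power_nbhd N n x"
      using m l \<open>z \<in> power_nbhd N m x\<close> by blast
    then show "\<exists>V. (clopen_set (power_nbhd N) V \<and> x \<in> V \<and> (Suc n = 0 \<longrightarrow> V = UNIV)) \<and>
        (V \<subset> U \<and> V \<subseteq> power_nbhd N n x)"
      using P.clopen_set_nbhd P.nbhd_self by blast
  qed (use P.clopen_set_UNIV in blast)
  then obtain U where "\<forall>n. (clopen_set (power_nbhd N) (U n) \<and> x \<in> U n \<and> (n = 0 \<longrightarrow> U n = UNIV)) \<and>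
      (U (Suc n) \<subset> U n \<and> U (Suc n) \<subseteq> power_nbhd N n x)" ..
  then show ?thesis by (intro exI[of _ U]) simp
qed

end

lemma shrinking_step:
  fixes U :: "nat \<Rightarrow> 'a set"
  assumes "U 0 = UNIV" "z \<notin> U m"
  shows "\<exists>n. z \<in> U n - U (Suc n)"
  using assms(2)
proof (induction m)
  case 0 then show ?case using assms(1) by simp
next
  case (Suc m) then show ?case by (cases "z \<in> U m") auto
qed

lemma shrinking_step_unique:
  fixes U :: "nat \<Rightarrow> 'a set"
  assumes "\<And>n. U (Suc n) \<subseteq> U n" "z \<in> U n - U (Suc n)" "z \<in> U m - U (Suc m)"
  shows "n = m"
proof -
  have anti: "U j \<subseteq> U i" if "i \<le> j" for i j
    using that by (rule lift_Suc_antimono_le[rotated]) (rule assms)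
  have "\<not> n < m" using anti[of "Suc n" m] assms by auto
  moreover have "\<not> m < n" using anti[of "Suc m" n] assms by auto
  ultimately show ?thesis by simp
qed

text \<open>Away from \<open>x\<close> the map agrees locally with a single \<open>f n\<close>,
  since rings are clopen. At \<open>x\<close>, points of \<open>U (Suc m)\<close> lie in rings of
  index at least \<open>Suc m\<close>, whose images lie in \<open>W (Suc m)\<close> and hence in
  \<open>N m y\<close>.\<close>

lemma (in clopen_nbhds) glue_rings:
  assumes U: "U 0 = UNIV" "\<And>n. clopen_set N (U n)" "\<And>n. x \<in> U n"
      "\<And>n. U (Suc n) \<subseteq> U n" "\<And>n. U (Suc n) \<subseteq> N n x"
    and W: "\<And>n. W (Suc n) \<subseteq> W n" "\<And>n. W (Suc n) \<subseteq> N n y"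
    and f: "\<And>n. nbhd_continuous N N (f n)" "\<And>n. f n ` (U n - U (Suc n)) \<subseteq> W n - W (Suc n)"
    and h: "h x = y" "\<And>n z. z \<in> U n - U (Suc n) \<Longrightarrow> h z = f n z"
  shows "nbhd_continuous N N h"
  unfolding nbhd_continuous_def
proof (intro allI)
  fix z m
  have U_anti: "U j \<subseteq> U i" if "i \<le> j" for i j
    using that by (rule lift_Suc_antimono_le[rotated]) (rule U)
  have W_anti: "W j \<subseteq> W i" if "i \<le> j" for i j
    using that by (rule lift_Suc_antimono_le[rotated]) (rule W)
  have ring: "\<exists>n. w \<in> U n - U (Suc n)" if "w \<noteq> x" for w
  proof -
    obtain k where "w \<notin> N k x" using nbhd_sep[OF \<open>w \<noteq> x\<close>[symmetric]] by blast
    then have "w \<notin> U (Suc k)" using U(5) by blast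
    then show ?thesis using shrinking_step[of U w "Suc k"] U(1) by blast
  qed
  show "\<exists>k. h ` N k z \<subseteq> N m (h z)"
  proof (cases "z = x")
    case True
    obtain k where k: "N k x \<subseteq> U (Suc m)" using U(2,3) clopen_setD by blast
    have "h w \<in> N m y" if w: "w \<in> N k x" for w
    proof (cases "w = x")
      case False
      then obtain n where n: "w \<in> U n - U (Suc n)" using ring by blast
      have "\<not> Suc n \<le> Suc m" using U_anti[of "Suc n" "Suc m"] n w k by blast
      then have "Suc m \<le> n" by simp
      moreover have "h w \<in> W n" using h(2)[OF n] f(2) n by fastforce
      ultimately show ?thesis using W_anti[of "Suc m" n] W(2)[of m] by blast
    qed (simp add: h nbhd_self)
    then show ?thesis using True h(1) by blast
  next
    case False
    then obtain n where n: "z \<in> U n - U (Suc n)" using ring by blast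
    then obtain k where k: "N k z \<subseteq> U n - U (Suc n)"
      using clopen_setD clopen_set_Diff U(2) by meson
    obtain l where l: "f n ` N l z \<subseteq> N m (f n z)" using f(1) unfolding nbhd_continuous_def by blast
    have "h w \<in> N m (h z)" if "w \<in> N (max k l) z" for w
    proof -
      have "w \<in> N k z" "w \<in> N l z"
        using that nbhd_anti[of k "max k l" z] nbhd_anti[of l "max k l" z] by auto
      then show ?thesis using k l h(2) n by fastforce
    qed
    then show ?thesis by blast
  qed
qed

lemma (in compact_clopen_nbhds) homogeneous_power:
  "homogeneous_space (nbhd_topology (power_nbhd N))"
  unfolding homogeneous_space_def
proof (intro ballI)
  interpret P: clopen_nbhds "power_nbhd N" by (rule clopen_nbhds_power)
  fix x y :: "nat \<Rightarrow> 'a"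
  obtain U where U: "U 0 = UNIV" "\<And>n. clopen_set (power_nbhd N) (U n)" "\<And>n. x \<in> U n"
    "\<And>n. U (Suc n) \<subset> U n" "\<And>n. U (Suc n) \<subseteq> power_nbhd N n x"
    using power_shrinking_base[of x] by metis
  obtain W where W: "W 0 = UNIV" "\<And>n. clopen_set (power_nbhd N) (W n)" "\<And>n. y \<in> W n"
    "\<And>n. W (Suc n) \<subset> W n" "\<And>n. W (Suc n) \<subseteq> power_nbhd N n y"
    using power_shrinking_base[of y] by metis
  have "clopen_equiv (power_nbhd N) (U n - U (Suc n)) (W n - W (Suc n))" for n
  proof -
    \<comment> \<open>Both rings are nonempty and clopen, hence equivalent to the whole power and so
      to each other.\<close>
    have "clopen_equiv (power_nbhd N) (U n - U (Suc n)) UNIV"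
      using U(2,4) P.clopen_set_Diff by (intro clopen_equiv_whole) blast+
    moreover have "clopen_equiv (power_nbhd N) (W n - W (Suc n)) UNIV"
      using W(2,4) P.clopen_set_Diff by (intro clopen_equiv_whole) blast+
    ultimately show ?thesis using clopen_equiv_sym clopen_equiv_trans by blast
  qed
  then obtain f g where fg: "\<And>n. nbhd_continuous (power_nbhd N) (power_nbhd N) (f n)"
     "\<And>n. nbhd_continuous (power_nbhd N) (power_nbhd N) (g n)"
     "\<And>n. f n ` (U n - U (Suc n)) \<subseteq> W n - W (Suc n)"
     "\<And>n. g n ` (W n - W (Suc n)) \<subseteq> U n - U (Suc n)"
     "\<And>n z. z \<in> U n - U (Suc n) \<Longrightarrow> g n (f n z) = z"
     "\<And>n z. z \<in> W n - W (Suc n) \<Longrightarrow> f n (g n z) = z"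
    unfolding clopen_equiv_def by metis
  \<comment> \<open>Every point other than the centre lies in exactly one ring, and that ring
    selects the map to apply.\<close>
  define h where "h = (\<lambda>z. if z = x then y else f (THE n. z \<in> U n - U (Suc n)) z)"
  define k where "k = (\<lambda>z. if z = y then x else g (THE n. z \<in> W n - W (Suc n)) z)"
  have h: "h z = f n z" if "z \<in> U n - U (Suc n)" for n z
  proof -
    have "(THE n. z \<in> U n - U (Suc n)) = n"
      using that shrinking_step_unique[of U z] U(4) by (intro the_equality) blast+
    moreover have "z \<noteq> x" using that U(3) by blast
    ultimately show ?thesis by (simp add: h_def)
  qed
  have k: "k z = g n z" if "z \<in> W n - W (Suc n)" for n z
  proof -
    have "(THE n. z \<in> W n - W (Suc n)) = n"
      using that shrinking_step_unique[of W z] W(4) by (intro the_equality) blast+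
    moreover have "z \<noteq> y" using that W(3) by blast
    ultimately show ?thesis by (simp add: k_def)
  qed
  have hx: "h x = y" and ky: "k y = x" by (simp_all add: h_def k_def)
  have "nbhd_continuous (power_nbhd N) (power_nbhd N) h"
    by (rule P.glue_rings[of U x W y f])
      (fact U(1-3) U(4)[THEN psubset_imp_subset] U(5) W(4)[THEN psubset_imp_subset] W(5)
        fg(1,3) hx h)+
  moreover have "nbhd_continuous (power_nbhd N) (power_nbhd N) k"
    by (rule P.glue_rings[of W y U x g])
      (fact W(1-3) W(4)[THEN psubset_imp_subset] W(5) U(4)[THEN psubset_imp_subset] U(5)
        fg(2,4) ky k)+
  moreover have "k (h z) = z" for z
  proof (cases "z = x")
    case False
    then obtain m where "z \<notin> power_nbhd N m x" using P.nbhd_sep by metis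
    then have "z \<notin> U (Suc m)" using U(5) by blast
    then obtain n where n: "z \<in> U n - U (Suc n)" using shrinking_step[of U z "Suc m"] U(1) by blast
    then have "f n z \<in> W n - W (Suc n)" using fg(3) by blast
    then show ?thesis using h[OF n] k fg(5)[OF n] by simp
  qed (simp add: hx ky)
  moreover have "h (k z) = z" for z
  proof (cases "z = y")
    case False
    then obtain m where "z \<notin> power_nbhd N m y" using P.nbhd_sep by metis
    then have "z \<notin> W (Suc m)" using W(5) by blast
    then obtain n where n: "z \<in> W n - W (Suc n)" using shrinking_step[of W z "Suc m"] W(1) by blast
    then have "g n z \<in> U n - U (Suc n)" using fg(4) by blast
    then show ?thesis using k[OF n] h fg(6)[OF n] by simp
  qed (simp add: hx ky)
  ultimately have "homeomorphic_maps (nbhd_topology (power_nbhd N)) (nbhd_topology (power_nbhd N)) h k"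
    by (simp add: homeomorphic_maps_def P.continuous_map_nbhd[OF clopen_nbhds_power])
  then show "\<exists>f. homeomorphic_map (nbhd_topology (power_nbhd N)) (nbhd_topology (power_nbhd N)) f \<and> f x = y"
    using hx homeomorphic_maps_map by blast
qed

section \<open>Consequences of the continuum hypothesis\<close>

type_synonym cantor = "nat \<Rightarrow> bool"

lemma cantor_eqpoll_reals: "(UNIV :: cantor set) \<approx> (UNIV :: real set)"
proof -
  have "bij_betw (\<lambda>A n. n \<in> A) (UNIV :: nat set set) (UNIV :: cantor set)"
    by (rule bij_betw_byWitness[where f' = Collect]) auto
  then have "(UNIV :: nat set set) \<approx> (UNIV :: cantor set)"
    unfolding eqpoll_def by blast
  then show ?thesis using eqpoll_sym eqpoll_trans nat_sets_eqpoll_reals by blast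
qed

lemma uncountable_cantor: "uncountable (UNIV :: cantor set)"
  using cantor_eqpoll_reals uncountable_UNIV_real countable_eqpoll eqpoll_sym by blast

lemma CH_cantor:
  fixes A :: "cantor set"
  assumes CH
  shows "countable A \<or> A \<approx> (UNIV :: cantor set)"
proof -
  obtain h :: "cantor \<Rightarrow> real" where h: "bij_betw h UNIV UNIV"
    using cantor_eqpoll_reals unfolding eqpoll_def by blast
  then have "inj_on h A" by (meson bij_betw_imp_inj_on inj_on_subset subset_UNIV)
  then have "A \<approx> h ` A" by (simp add: inj_on_image_eqpoll_self eqpoll_sym)
  moreover have "countable (h ` A) \<or> h ` A \<approx> (UNIV :: real set)"
    using assms unfolding CH_def by blast
  ultimately show ?thesis
    using cantor_eqpoll_reals countable_eqpoll eqpoll_sym eqpoll_trans by meson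
qed

text \<open>In the cardinal order of the Cantor set every proper initial segment has smaller
  cardinality, hence is countable under \<open>CH\<close>. The strict part is taken for use in
  well-founded recursion.\<close>

lemma CH_wellorder:
  assumes CH
  obtains R :: "cantor rel"
  where "wf R" "trans R" "total R" "\<forall>x. countable {y. (y, x) \<in> R}"
proof -
  define r where "r = card_of (UNIV :: cantor set)"
  have r: "card_order_on UNIV r" "Card_order r" "Field r = UNIV"
    unfolding r_def by (simp_all add: card_of_card_order_on Field_card_of)
  have wo: "well_order_on UNIV r" using r(1) unfolding card_order_on_def by blast
  then have lin: "linear_order_on UNIV r" and wf: "wf (r - Id)" 
    unfolding well_order_on_def by blast+
  then have "trans r" "antisym r" "total r"
    unfolding linear_order_on_def partial_order_on_def preorder_on_def by auto
  show thesis
  proof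
    show "wf (r - Id)" by fact
    show "trans (r - Id)" by (rule trans_diff_Id) fact+
    show "total (r - Id)" using \<open>total r\<close> by (simp add: total_on_def)
    show "\<forall>x. countable {y. (y, x) \<in> r - Id}"
    proof
      fix x
      have "(card_of (underS r x), card_of (UNIV :: cantor set)) \<in> ordLess"
        using card_of_underS[of r x] r unfolding r_def by blast
      then have "\<not> underS r x \<approx> (UNIV :: cantor set)"
        unfolding eqpoll_def card_of_ordIso using not_ordLess_ordIso by blast
      then have "countable (underS r x)" using CH_cantor[OF assms] by blast
      moreover have "underS r x = {y. (y, x) \<in> r - Id}" by (auto simp: underS_def)
      ultimately show "countable {y. (y, x) \<in> r - Id}" by simp
    qed
  qed
qed

text \<open>A single point codes a whole sequence of tuples (\<open>k\<close> numbers the tuple,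
  \<open>i\<close> the coordinate), so every countable family of tuples appears as a stage of the
  recursion.\<close>

definition sequence_code :: "cantor \<Rightarrow> nat \<Rightarrow> nat \<Rightarrow> cantor" where
  "sequence_code c k i m = c (prod_encode (k, prod_encode (i, m)))"

lemma surj_sequence_code: "\<exists>c. sequence_code c = s"
proof
  show "sequence_code (\<lambda>n. case prod_decode n of (k, l) \<Rightarrow> case prod_decode l of (i, m) \<Rightarrow> s k i m) = s"
    by (simp add: sequence_code_def fun_eq_iff)
qed

definition cyl :: "cantor \<Rightarrow> nat \<Rightarrow> cantor set" where
  "cyl x n = {y. \<forall>i<n. y i = x i}"

lemma cyl_self: "x \<in> cyl x n"
  by (simp add: cyl_def)

lemma cyl_eq: "y \<in> cyl x n \<Longrightarrow> cyl y n = cyl x n"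
  by (auto simp: cyl_def)

lemma cyl_anti: "m \<le> n \<Longrightarrow> cyl x n \<subseteq> cyl x m"
  by (auto simp: cyl_def)

lemma cyl_sep: "x \<noteq> y \<Longrightarrow> \<exists>n. cyl x n \<inter> cyl y n = {}"
proof -
  assume "x \<noteq> y"
  then obtain i where "x i \<noteq> y i" by blast
  then have "cyl x (Suc i) \<inter> cyl y (Suc i) = {}" by (auto simp: cyl_def)
  then show ?thesis by blast
qed

lemma countable_cyls: "countable (range (\<lambda>(x, n). cyl x n))"
proof -
  have "cyl x n = (\<lambda>l. {y. \<forall>i<length l. y i = l ! i}) (map x [0..<n])" for x n
    by (simp add: cyl_def)
  then have "(case p of (x, n) \<Rightarrow> cyl x n) \<in> range (\<lambda>l::bool list. {y::cantor. \<forall>i<length l. y i = l ! i})"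
    for p by (cases p) (auto simp only: split_conv intro: rangeI)
  then have "range (\<lambda>(x, n). cyl x n) \<subseteq> range (\<lambda>l::bool list. {y::cantor. \<forall>i<length l. y i = l ! i})"
    by (rule image_subsetI)
  then show ?thesis by (rule countable_subset) (rule countable_image, rule countableI_type)
qed

lemma uncountable_cyl: "uncountable (cyl x n)"
proof
  assume "countable (cyl x n)"
  then have "countable ((\<lambda>y i. y (i + n)) ` cyl x n)" by blast
  moreover have "z \<in> (\<lambda>y i. y (i + n)) ` cyl x n" for z :: cantor
    by (rule image_eqI[of _ _ "\<lambda>i. if i < n then x i else z (i - n)"]) (auto simp: cyl_def)
  then have "(\<lambda>y i. y (i + n)) ` cyl x n = (UNIV :: cantor set)" by blast
  ultimately show False using uncountable_cantor by simp
qed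

text \<open>Compactness of the Cantor space by Tychonoff, in the form needed to cover the duplicate:
  one cylinder is prescribed at each point.\<close>

lemma cyl_compact:
  fixes m :: "cantor \<Rightarrow> nat"
  shows "\<exists>F. finite F \<and> (\<Union>x\<in>F. cyl x (m x)) = UNIV"
proof -
  let ?C = "product_topology (\<lambda>_::nat. discrete_topology (UNIV :: bool set)) UNIV"
  have "compact_space ?C"
    by (simp add: compact_space_product_topology compact_space_discrete_topology)
  moreover have "openin ?C (cyl x n)" for x n
  proof -
    have "cyl x n = (\<Pi>\<^sub>E i\<in>UNIV. if i < n then {x i} else UNIV)"
      by (auto simp: cyl_def PiE_iff split: if_splits)
    moreover have "finite {i. (if i < n then {x i} else UNIV) \<noteq> UNIV}"
      by (rule finite_subset[of _ "{..<n}"]) auto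
    ultimately show ?thesis by (simp add: product_topology_basis)
  qed
  moreover have "UNIV \<subseteq> \<Union>(range (\<lambda>x. cyl x (m x)))" using cyl_self by blast
  ultimately have "\<exists>\<F>. finite \<F> \<and> \<F> \<subseteq> range (\<lambda>x. cyl x (m x)) \<and> UNIV \<subseteq> \<Union>\<F>"
    unfolding compact_space_def by (intro compactinD[of ?C]) auto
  then obtain \<F> where \<F>: "finite \<F>" "\<F> \<subseteq> range (\<lambda>x. cyl x (m x))" "UNIV \<subseteq> \<Union>\<F>" by blast
  then obtain F where "finite F" "\<F> = (\<lambda>x. cyl x (m x)) ` F" using finite_subset_image[OF \<F>(1,2)] by blast
  with \<F> show ?thesis by blast
qed

section \<open>The locally countable refinement of the Cantor topology\<close>

text \<open>\<open>t x\<close> is a sequence of earlier points converging to \<open>x\<close> in the Cantor topology; indices \<open>k\<close> for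
  which \<open>t x k\<close> is not earlier than \<open>x\<close> are ignored.\<close>

inductive ladder_reach :: "cantor rel \<Rightarrow> (cantor \<Rightarrow> nat \<Rightarrow> cantor) \<Rightarrow> nat \<Rightarrow> cantor \<Rightarrow> cantor \<Rightarrow> bool"
  for R t where
  refl: "ladder_reach R t m x x"
| step: "m \<le> k \<Longrightarrow> (t x k, x) \<in> R \<Longrightarrow> ladder_reach R t k (t x k) y \<Longrightarrow> ladder_reach R t m x y"

definition ladder_nbhd :: "cantor rel \<Rightarrow> (cantor \<Rightarrow> nat \<Rightarrow> cantor) \<Rightarrow> nat \<Rightarrow> cantor \<Rightarrow> cantor set" where
  "ladder_nbhd R t m x = {y. ladder_reach R t m x y}"

text \<open>The countably many sets known at stage \<open>x\<close>: the Cantor base and the new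
  neighbourhoods of earlier points.\<close>

definition constraint_sets :: "cantor rel \<Rightarrow> (cantor \<Rightarrow> nat \<Rightarrow> cantor) \<Rightarrow> cantor \<Rightarrow> cantor set set" where
  "constraint_sets R t x = range (\<lambda>(y, n). cyl y n) \<union> (\<lambda>(m, y). ladder_nbhd R t m y) ` (UNIV \<times> {y. (y, x) \<in> R})"

text \<open>Here \<open>b\<close> codes a sequence of tuples and \<open>Qs\<close> prescribes neighbourhoods for their coordinates
  other than the \<open>i\<close>-th.\<close>

definition ladder_trace :: "cantor rel \<Rightarrow> cantor \<Rightarrow> cantor \<Rightarrow> nat \<Rightarrow> cantor set list \<Rightarrow> cantor set" where
  "ladder_trace R x b i Qs = {sequence_code b k i |k. (sequence_code b k i, x) \<in> R \<and>
     (\<forall>j<length Qs. j \<noteq> i \<longrightarrow> sequence_code b k j \<in> Qs ! j)}"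

text \<open>The first clause is convergence in the Cantor topology. The second says that every trace
  coded at or before stage \<open>x\<close> and accumulating at \<open>x\<close> is visited
  infinitely often.\<close>

definition catches :: "cantor rel \<Rightarrow> (cantor \<Rightarrow> nat \<Rightarrow> cantor) \<Rightarrow> cantor \<Rightarrow> (nat \<Rightarrow> cantor) \<Rightarrow> bool" where
  "catches R t x r \<longleftrightarrow> (\<forall>k. r k \<in> cyl x k) \<and>
     (\<forall>b i Qs. (b = x \<or> (b, x) \<in> R) \<longrightarrow> set Qs \<subseteq> constraint_sets R t x \<longrightarrow>
        (\<forall>m. ladder_trace R x b i Qs \<inter> cyl x m \<noteq> {}) \<longrightarrow> (\<forall>m. \<exists>k\<ge>m. r k \<in> ladder_trace R x b i Qs))"

text \<open>Paths from a point below \<open>x\<close> stay below \<open>x\<close> by transitivity.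
  Hence the requirement at stage \<open>x\<close> depends only on earlier ladders, as well-founded
  recursion demands.\<close>

lemma ladder_reach_cong:
  assumes "trans R" "\<And>z. (z, x) \<in> R \<Longrightarrow> f z = g z"
  shows "ladder_reach R f m y w \<Longrightarrow> (y, x) \<in> R \<Longrightarrow> ladder_reach R g m y w"
proof (induction rule: ladder_reach.induct)
  case (step m k y w)
  then have "ladder_reach R g k (f y k) w" using assms(1) by (meson transD)
  moreover have "f y k = g y k" using assms(2) step.prems by metis
  ultimately show ?case using step.hyps by (metis ladder_reach.step)
qed (rule ladder_reach.refl)

lemma constraint_sets_cong:
  assumes "trans R" "\<And>z. (z, x) \<in> R \<Longrightarrow> f z = g z"
  shows "constraint_sets R f x = constraint_sets R g x"
proof -
  have "ladder_nbhd R f m y = ladder_nbhd R g m y" if "(y, x) \<in> R" for m y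
    unfolding ladder_nbhd_def
    using ladder_reach_cong[OF assms(1), of x f g] ladder_reach_cong[OF assms(1), of x g f] assms(2) that
    by fastforce
  then show ?thesis unfolding constraint_sets_def by (intro arg_cong2[of _ _ _ _ "(\<union>)"] image_cong) auto
qed

lemma catches_exists:
  assumes "countable {y. (y, x) \<in> R}"
  shows "\<exists>r. catches R t x r"
proof -
  define \<T> where "\<T> = (\<lambda>(b, i, Qs). ladder_trace R x b i Qs) `
      ({b. b = x \<or> (b, x) \<in> R} \<times> UNIV \<times> lists (constraint_sets R t x))"
  have "countable (constraint_sets R t x)"
    unfolding constraint_sets_def using assms
    by (intro countable_Un countable_cyls countable_image countable_SIGMA) auto
  moreover have "{b. b = x \<or> (b, x) \<in> R} = insert x {y. (y, x) \<in> R}" by auto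
  ultimately have "countable \<T>"
    unfolding \<T>_def using assms by (intro countable_image countable_SIGMA countable_lists) simp_all
  moreover have "\<T> \<noteq> {}" unfolding \<T>_def by auto
  ultimately have range: "range (from_nat_into \<T>) = \<T>" by (rule range_from_nat_into[rotated])
  \<comment> \<open>The pairing function makes each trace come up at infinitely many
    \<open>k\<close>. If it misses \<open>cyl x k\<close>, the default \<open>x\<close> keeps the
    sequence convergent.\<close>
  define r where "r = (\<lambda>k. let T = from_nat_into \<T> (fst (prod_decode k)) in
      if T \<inter> cyl x k = {} then x else SOME y. y \<in> T \<inter> cyl x k)"
  have r_cyl: "r k \<in> cyl x k" for k
  proof -
    let ?T = "from_nat_into \<T> (fst (prod_decode k)) \<inter> cyl x k"
    have "(SOME y. y \<in> ?T) \<in> ?T" if "?T \<noteq> {}" using that by (rule some_in_eq[THEN iffD2])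
    then show ?thesis using cyl_self[of x k] unfolding r_def Let_def by auto
  qed
  have r_T: "r k \<in> T" if "T = from_nat_into \<T> (fst (prod_decode k))" "T \<inter> cyl x k \<noteq> {}" for k T
    unfolding r_def Let_def using that some_in_eq[of "T \<inter> cyl x k"] by simp
  have "\<exists>k\<ge>m. r k \<in> T" if T: "T \<in> \<T>" "\<forall>m. T \<inter> cyl x m \<noteq> {}" for T m
  proof -
    obtain j where j: "T = from_nat_into \<T> j" using T(1) range by (metis imageE)
    then have "r (prod_encode (j, m)) \<in> T" using T by (intro r_T) auto
    then show ?thesis using le_prod_encode_2 by blast
  qed
  moreover have "ladder_trace R x b i Qs \<in> \<T>"
    if "b = x \<or> (b, x) \<in> R" "set Qs \<subseteq> constraint_sets R t x" for b i Qs
    unfolding \<T>_def by (rule image_eqI[of _ _ "(b, i, Qs)"]) (use that in auto)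
  ultimately have "catches R t x r"
    unfolding catches_def using r_cyl by blast
  then show ?thesis by (rule exI[of "catches R t x" r])
qed

lemma ladder_exists:
  assumes "wf R" "trans R" "\<forall>x. countable {y. (y, x) \<in> R}"
  shows "\<exists>t. \<forall>x. catches R t x (t x)"
proof (rule dependent_wf_choice[OF assms(1)])
  fix f g :: "cantor \<Rightarrow> nat \<Rightarrow> cantor" and x r assume "\<And>z. (z, x) \<in> R \<Longrightarrow> f z = g z"
  then show "catches R f x r = catches R g x r"
    unfolding catches_def using constraint_sets_cong[OF assms(2)] by metis
next
  fix x :: cantor and f :: "cantor \<Rightarrow> nat \<Rightarrow> cantor"
  show "\<exists>r. catches R f x r"
    using assms(3) by (intro catches_exists) simp
qed

section \<open>Local structure of the new topology\<close>

locale kunen_ladder =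
  fixes R :: "cantor rel" and t :: "cantor \<Rightarrow> nat \<Rightarrow> cantor"
  assumes wf: "wf R" and trans: "trans R" and total: "total R"
    and countable_below: "countable {y. (y, x) \<in> R}"
    and catches: "catches R t x (t x)"
begin

abbreviation V where "V \<equiv> ladder_nbhd R t"

lemma ladder_near: "t x k \<in> cyl x k"
  using catches unfolding catches_def by blast

lemma V_self: "x \<in> V m x"
  by (simp add: ladder_nbhd_def ladder_reach.refl)

lemma V_unfold: "V m x = insert x (\<Union>k\<in>{k. m \<le> k \<and> (t x k, x) \<in> R}. V k (t x k))"
proof (rule set_eqI)
  fix y
  show "y \<in> V m x \<longleftrightarrow> y \<in> insert x (\<Union>k\<in>{k. m \<le> k \<and> (t x k, x) \<in> R}. V k (t x k))"
    unfolding ladder_nbhd_def using ladder_reach.simps[of R t m x y] by auto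
qed

lemma V_step: "m \<le> k \<Longrightarrow> (t x k, x) \<in> R \<Longrightarrow> V k (t x k) \<subseteq> V m x"
  by (subst (2) V_unfold) blast

lemma V_anti: "m \<le> k \<Longrightarrow> V k x \<subseteq> V m x"
  by (subst (1 2) V_unfold) fastforce

text \<open>Shows that the new topology refines the Cantor topology: a ladder step with index
  \<open>k\<close> stays in \<open>cyl x k\<close>.\<close>

lemma V_cyl: "V m x \<subseteq> cyl x m"
proof
  fix y assume "y \<in> V m x"
  then have "ladder_reach R t m x y" by (simp add: ladder_nbhd_def)
  then show "y \<in> cyl x m"
  proof (induction rule: ladder_reach.induct)
    case (step m k x y)
    then have "y \<in> cyl x k" using cyl_eq ladder_near by blast
    then show ?case using cyl_anti step.hyps by blast
  qed (rule cyl_self)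
qed

text \<open>Each ladder step descends in \<open>R\<close>; since initial segments are countable, the
  new topology is locally countable.\<close>

lemma V_below: "V m x \<subseteq> insert x {y. (y, x) \<in> R}"
proof
  fix y assume "y \<in> V m x"
  then have "ladder_reach R t m x y" by (simp add: ladder_nbhd_def)
  then show "y \<in> insert x {y. (y, x) \<in> R}"
    by (induction rule: ladder_reach.induct) (use trans in \<open>auto dest: transD\<close>)
qed

lemma countable_V: "countable (V m x)"
  using V_below countable_below by (meson countable_insert countable_subset)

lemma V_open: "y \<in> V m x \<Longrightarrow> \<exists>k. V k y \<subseteq> V m x"
proof -
  assume "y \<in> V m x"
  then have "ladder_reach R t m x y" by (simp add: ladder_nbhd_def)
  then show ?thesis
  proof (induction rule: ladder_reach.induct)
    case (step m k x y)
    then show ?case using V_step by blast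
  qed blast
qed

text \<open>By induction on \<open>x\<close>: only finitely many pieces of \<open>V m x\<close> come close to a point \<open>y \<noteq> x\<close>.\<close>

lemma V_local:
  assumes "y \<in> V m x \<Longrightarrow> V 0 y \<subseteq> W"
  shows "\<exists>k. V m x \<inter> cyl y k \<subseteq> W"
  using assms
proof (induction x arbitrary: m rule: wf_induct_rule[OF wf])
  case (1 x)
  show ?case
  proof (cases "x = y")
    case True
    then show ?thesis using 1(2) V_self V_anti[of 0 m x] by blast
  next
    case False
    then obtain m0 where m0: "cyl x m0 \<inter> cyl y m0 = {}" using cyl_sep by blast
    \<comment> \<open>Pieces with index at least \<open>m0\<close> lie in \<open>cyl x m0\<close>,
      away from \<open>y\<close>; the finitely many others are handled by the induction
      hypothesis.\<close>
    have "\<exists>K. \<forall>k<m0. m \<le> k \<and> (t x k, x) \<in> R \<longrightarrow> V k (t x k) \<inter> cyl y K \<subseteq> W"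
    proof (rule ex_uniform_bound)
      fix k
      show "\<exists>K. m \<le> k \<and> (t x k, x) \<in> R \<longrightarrow> V k (t x k) \<inter> cyl y K \<subseteq> W"
        using 1 V_step by blast
    qed (use cyl_anti in blast)
    then obtain K where K: "\<And>k. k < m0 \<Longrightarrow> m \<le> k \<Longrightarrow> (t x k, x) \<in> R \<Longrightarrow> V k (t x k) \<inter> cyl y K \<subseteq> W"
      by blast
    have "V m x \<inter> cyl y (max m0 K) \<subseteq> W"
    proof
      fix z assume z: "z \<in> V m x \<inter> cyl y (max m0 K)"
      then have zm: "z \<in> cyl y m0" "z \<in> cyl y K"
        using cyl_anti[of m0 "max m0 K" y] cyl_anti[of K "max m0 K" y] by auto
      then have "z \<noteq> x" using m0 cyl_self by blast
      then obtain k where k: "m \<le> k" "(t x k, x) \<in> R" "z \<in> V k (t x k)"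
        using z V_unfold[of m x] by blast
      show "z \<in> W"
      proof (cases "k < m0")
        case False
        have "z \<in> cyl x k" using k V_cyl[of k "t x k"] cyl_eq[OF ladder_near] by blast
        then have "z \<in> cyl x m0" using cyl_anti[of m0 k x] False by auto
        then show ?thesis using zm m0 by blast
      qed (use K k zm in blast)
    qed
    then show ?thesis by blast
  qed
qed

text \<open>With empty \<open>W\<close>, \<open>V_local\<close> says that the new basic sets are
  closed even in the Cantor topology.\<close>

lemma V_closed: "y \<notin> V m x \<Longrightarrow> \<exists>k. V m x \<inter> cyl y k = {}"
  using V_local[of y m x "{}"] by blast

text \<open>Otherwise the whole Cantor set would be a countable union of countable initial
  segments.\<close>

lemma bounded_above:
  assumes "countable A"
  shows "\<exists>b. \<forall>a\<in>A. (a, b) \<in> R"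
proof (rule ccontr)
  assume "\<not> ?thesis"
  then have "UNIV \<subseteq> (\<Union>a\<in>A. insert a {b. (b, a) \<in> R})"
    using total unfolding total_on_def by blast
  moreover have "countable (\<Union>a\<in>A. insert a {b. (b, a) \<in> R})"
    using assms countable_below by blast
  ultimately show False using uncountable_cantor countable_subset by blast
qed

lemma ex_largest:
  assumes "finite J" "J \<noteq> {}" "inj_on a J"
  shows "\<exists>i\<in>J. \<forall>j\<in>J - {i}. (a j, a i) \<in> R"
  using assms
proof (induction J rule: finite_ne_induct)
  case (insert l J)
  then obtain i where i: "i \<in> J" "\<forall>j\<in>J - {i}. (a j, a i) \<in> R" by auto
  have "a l \<noteq> a i" using insert.prems insert.hyps i by (auto simp: inj_on_def)
  then consider "(a l, a i) \<in> R" | "(a i, a l) \<in> R" using total unfolding total_on_def by blast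
  then show ?case
  proof cases
    case 1 then show ?thesis using i by (intro bexI[of _ i]) auto
  next
    case 2
    have "(a j, a l) \<in> R" if "j \<in> J" for j
      using i 2 that trans by (cases "j = i") (auto dest: transD)
    then show ?thesis by blast
  qed
qed simp

text \<open>Cantor neighbourhoods are replaced by new ones coordinate by coordinate, the largest \<open>a i\<close> last, so
  that the constraints on the other coordinates are already known at stage \<open>a i\<close>.\<close>

lemma catch_tuples:
  assumes "finite J" "J \<subseteq> {..<n}" "inj_on a J"
    and below: "\<And>i. i \<in> J \<Longrightarrow> (b, a i) \<in> R" "\<And>i k. i \<in> J \<Longrightarrow> (sequence_code b k i, a i) \<in> R"
    and dense: "\<And>m. \<exists>k. \<forall>i<n. sequence_code b k i \<in> cyl (a i) m"
  shows "\<exists>k. \<forall>i<n. sequence_code b k i \<in> (if i \<in> J then V m (a i) else cyl (a i) m)"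
  using assms(1-3) below
proof (induction J arbitrary: m rule: finite_psubset_induct)
  case (psubset J)
  show ?case
  proof (cases "J = {}")
    case True
    then show ?thesis using dense by simp
  next
    case False
    then obtain i where i: "i \<in> J" "\<And>j. j \<in> J - {i} \<Longrightarrow> (a j, a i) \<in> R"
      using ex_largest psubset by metis
    \<comment> \<open>Every \<open>a j\<close> with \<open>j\<close> in \<open>J - {i}\<close>
      precedes \<open>a i\<close>, so these sets are all available as constraints at stage
      \<open>a i\<close>.\<close>
    define Qs where "Qs = map (\<lambda>j. if j \<in> J - {i} then V m (a j) else cyl (a j) m) [0..<n]"
    have "set Qs \<subseteq> constraint_sets R t (a i)"
      unfolding Qs_def constraint_sets_def using i(2) by (auto split: if_splits)
    moreover have "ladder_trace R (a i) b i Qs \<inter> cyl (a i) l \<noteq> {}" for l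
    proof -
      \<comment> \<open>The index \<open>max l m\<close> brings coordinate \<open>i\<close> within
        \<open>l\<close> of \<open>a i\<close> while the others still meet their constraints at
        \<open>m\<close>.\<close>
      have "\<exists>k. \<forall>j<n. sequence_code b k j \<in>
          (if j \<in> J - {i} then V (max l m) (a j) else cyl (a j) (max l m))"
        using i(1) psubset.prems by (intro psubset.IH) (auto intro: inj_on_diff)
      then obtain k where k: "\<And>j. j < n \<Longrightarrow> sequence_code b k j \<in>
          (if j \<in> J - {i} then V (max l m) (a j) else cyl (a j) (max l m))" by blast
      have "i < n" using i(1) psubset.prems by blast
      then have "sequence_code b k i \<in> cyl (a i) l"
        using k[of i] cyl_anti[of l "max l m" "a i"] by auto
      moreover have "sequence_code b k j \<in> Qs ! j" if "j < length Qs" for j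
        using k[of j] that cyl_anti[of m "max l m" "a j"] V_anti[of m "max l m" "a j"]
        by (auto simp: Qs_def split: if_splits)
      ultimately show ?thesis using psubset.prems i(1) unfolding ladder_trace_def by blast
    qed
    ultimately obtain l where l: "l \<ge> m" "t (a i) l \<in> ladder_trace R (a i) b i Qs"
      using catches[of "a i"] psubset.prems(3)[OF i(1)] unfolding catches_def by blast
    \<comment> \<open>The tuple caught has its \<open>i\<close>-th coordinate on the ladder of
      \<open>a i\<close> at an index at least \<open>m\<close>, hence in
      \<open>V m (a i)\<close>.\<close>
    then obtain k where k: "t (a i) l = sequence_code b k i" "(t (a i) l, a i) \<in> R"
       "\<And>j. j < length Qs \<Longrightarrow> j \<noteq> i \<Longrightarrow> sequence_code b k j \<in> Qs ! j"
      unfolding ladder_trace_def by auto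
    have "sequence_code b k i \<in> V m (a i)"
      using V_step[OF l(1) k(2)] V_self k(1) by auto
    moreover have "sequence_code b k j \<in> (if j \<in> J then V m (a j) else cyl (a j) m)"
      if "j < n" "j \<noteq> i" for j
      using that k(3)[of j] by (cases "j \<in> J") (simp_all add: Qs_def)
    ultimately have "\<forall>j<n. sequence_code b k j \<in> (if j \<in> J then V m (a j) else cyl (a j) m)"
      using i(1) by metis
    then show ?thesis by blast
  qed
qed

text \<open>Second countability of finite Cantor powers: one point of \<open>A\<close> is chosen for
  each list of cylinders that contains one.\<close>

lemma cyl_dense:
  fixes A :: "(nat \<Rightarrow> cantor) set"
  shows "\<exists>D\<subseteq>A. countable D \<and> (\<forall>a\<in>A. \<forall>m. \<exists>d\<in>D. \<forall>i<n. d i \<in> cyl (a i) m)"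
proof -
  define L where "L = {Cs \<in> lists (range (\<lambda>(x, n). cyl x n)). \<exists>a\<in>A. \<forall>i<n. a i \<in> Cs ! i}"
  have "\<forall>Cs\<in>L. \<exists>d. d \<in> A \<and> (\<forall>i<n. d i \<in> Cs ! i)" by (auto simp: L_def)
  then obtain d where d: "\<And>Cs. Cs \<in> L \<Longrightarrow> d Cs \<in> A \<and> (\<forall>i<n. d Cs i \<in> Cs ! i)" by metis
  show ?thesis
  proof (intro exI[of _ "d ` L"] conjI ballI allI)
    show "d ` L \<subseteq> A" using d by blast
    have "countable L" 
      unfolding L_def using countable_lists[OF countable_cyls] countable_subset by (metis (no_types, lifting) mem_Collect_eq subsetI)
    then show "countable (d ` L)" by blast
    fix a m assume "a \<in> A"
    let ?Cs = "map (\<lambda>i. cyl (a i) m) [0..<n]"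
    have "?Cs \<in> L" unfolding L_def using \<open>a \<in> A\<close> by (auto simp: cyl_self in_lists_conv_set intro!: bexI[of _ a])
    then show "\<exists>d\<in>d ` L. \<forall>i<n. d i \<in> cyl (a i) m" using d[of ?Cs] by force
  qed
qed

text \<open>Tuples with a coordinate below \<open>\<beta>\<close> or with two equal coordinates reduce to a smaller \<open>J\<close>; the
  remaining ones are caught.\<close>

lemma mixed_dense:
  fixes A :: "(nat \<Rightarrow> cantor) set"
  assumes "finite J" "J \<subseteq> {..<n}"
  shows "\<exists>D\<subseteq>A. countable D \<and>
    (\<forall>a\<in>A. \<forall>m. \<exists>d\<in>D. \<forall>i<n. d i \<in> (if i \<in> J then V m (a i) else cyl (a i) m))"
  using assms
proof (induction J arbitrary: A rule: finite_psubset_induct)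
  case (psubset J)
  define ok where "ok = (\<lambda>J m a d. \<forall>i<n. d i \<in> (if i \<in> J then V m (a i) else cyl (a i) m))"
  have "\<forall>i A. \<exists>D. i \<in> J \<longrightarrow> D \<subseteq> A \<and> countable D \<and> (\<forall>a\<in>A. \<forall>m. \<exists>d\<in>D. ok (J - {i}) m a d)"
  proof (intro allI)
    fix i A
    show "\<exists>D. i \<in> J \<longrightarrow> D \<subseteq> A \<and> countable D \<and> (\<forall>a\<in>A. \<forall>m. \<exists>d\<in>D. ok (J - {i}) m a d)"
    proof (cases "i \<in> J")
      case True
      then have "J - {i} \<subset> J" "J - {i} \<subseteq> {..<n}" using psubset.prems by auto
      from psubset.IH[OF this, of A] show ?thesis unfolding ok_def by blast
    qed blast
  qed
  then obtain D where D: "\<And>i A. i \<in> J \<Longrightarrow> D i A \<subseteq> A" "\<And>i A. i \<in> J \<Longrightarrow> countable (D i A)"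
     "\<And>i A a m. i \<in> J \<Longrightarrow> a \<in> A \<Longrightarrow> \<exists>d\<in>D i A. ok (J - {i}) m a d"
    by metis
  obtain D0 where D0: "D0 \<subseteq> A" "countable D0" "\<And>a m. a \<in> A \<Longrightarrow> \<exists>d\<in>D0. \<forall>i<n. d i \<in> cyl (a i) m"
    using cyl_dense[of A n] by metis
  \<comment> \<open>\<open>b\<close> codes an enumeration of \<open>D0\<close>, and
    \<open>\<beta>\<close> is taken above \<open>b\<close> and all coordinates so coded.\<close>
  obtain b where b: "sequence_code b = from_nat_into D0" using surj_sequence_code by blast
  have "countable (insert b (range (\<lambda>(k, i). sequence_code b k i)))" by simp
  from bounded_above[OF this] obtain \<beta>
    where "\<forall>a\<in>insert b (range (\<lambda>(k, i). sequence_code b k i)). (a, \<beta>) \<in> R" ..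
  then have \<beta>: "(b, \<beta>) \<in> R" "\<And>k i. (sequence_code b k i, \<beta>) \<in> R"
    by auto
  \<comment> \<open>Only countably many values \<open>c\<close> are small, and a coordinate fixed at
    \<open>c\<close> lies in every \<open>V m c\<close>. In \<open>E2\<close>, coordinate
    \<open>i\<close> repeats coordinate \<open>j\<close>, so its neighbourhood condition is
    inherited.\<close>
  define E1 where "E1 = (\<Union>i\<in>J. \<Union>c\<in>insert \<beta> {c. (c, \<beta>) \<in> R}. D i {a \<in> A. a i = c})"
  define E2 where "E2 = (\<Union>i\<in>J. \<Union>j\<in>J - {i}. D i {a \<in> A. a i = a j})"
  have fin: "finite J" by fact
  have "countable E1"
    unfolding E1_def by (intro countable_UN countable_insert countable_below countable_finite fin D(2))
  moreover have "countable E2"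
    unfolding E2_def using fin by (intro countable_UN countable_finite D(2)) auto
  ultimately have "countable (D0 \<union> E1 \<union> E2)"
    using D0(2) by simp
  moreover have "D0 \<union> E1 \<union> E2 \<subseteq> A"
  proof -
    have "D i {a \<in> A. P a} \<subseteq> A" if "i \<in> J" for i P
      using D(1)[OF that, of "{a \<in> A. P a}"] by blast
    then show ?thesis unfolding E1_def E2_def by (intro Un_least UN_least D0(1)) auto
  qed
  moreover have "\<exists>d\<in>D0 \<union> E1 \<union> E2. ok J m a d" if "a \<in> A" for a m
  proof -
    consider (small) i where "i \<in> J" "a i = \<beta> \<or> (a i, \<beta>) \<in> R"
      | (repeated) i j where "i \<in> J" "j \<in> J" "i \<noteq> j" "a i = a j"
      | (generic) "\<And>i. i \<in> J \<Longrightarrow> (\<beta>, a i) \<in> R" "inj_on a J"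
      using total unfolding total_on_def inj_on_def by (metis UNIV_I)
    then show ?thesis
    proof cases
      case small
      let ?A = "{a' \<in> A. a' i = a i}"
      obtain d where d: "d \<in> D i ?A" "ok (J - {i}) m a d"
        using D(3)[of i a ?A m] small \<open>a \<in> A\<close> by auto
      moreover have "d i = a i" using D(1) small d by blast
      ultimately have "ok J m a d" unfolding ok_def using V_self
        by (metis Diff_iff singletonD)
      moreover have "d \<in> E1" using d(1) small unfolding E1_def by blast
      ultimately show ?thesis by blast
    next
      case repeated
      let ?A = "{a' \<in> A. a' i = a' j}"
      obtain d where d: "d \<in> D i ?A" "ok (J - {i}) m a d"
        using D(3)[of i a ?A m] repeated \<open>a \<in> A\<close> by auto
      have "d i = d j" using D(1)[of i ?A] repeated d by blast
      moreover have "d j \<in> V m (a j)" using d(2) repeated psubset.prems unfolding ok_def by auto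
      ultimately have "d i \<in> V m (a i)" using repeated by simp
      then have "ok J m a d" using d(2) unfolding ok_def
        by (metis Diff_iff singletonD)
      moreover have "d \<in> E2" using d(1) repeated unfolding E2_def by blast
      ultimately show ?thesis by blast
    next
      case generic
      have "D0 \<noteq> {}" using D0(3) \<open>a \<in> A\<close> by blast
      then have range: "range (sequence_code b) = D0" using D0(2) b range_from_nat_into by simp
      have "\<exists>k. \<forall>i<n. sequence_code b k i \<in> (if i \<in> J then V m (a i) else cyl (a i) m)"
      proof (rule catch_tuples[OF fin psubset.prems generic(2)])
        show "(b, a i) \<in> R" if "i \<in> J" for i
          using \<beta>(1) generic(1)[OF that] trans by (meson transD)
        show "(sequence_code b k i, a i) \<in> R" if "i \<in> J" for i k
          using \<beta>(2) generic(1)[OF that] trans by (meson transD)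
        show "\<exists>k. \<forall>i<n. sequence_code b k i \<in> cyl (a i) m" for m
          using D0(3)[OF \<open>a \<in> A\<close>, of m] range by (metis imageE)
      qed
      then show ?thesis unfolding ok_def using range by (metis UnI1 rangeI)
    qed
  qed
  ultimately show ?case unfolding ok_def by blast
qed

end

section \<open>The Alexandroff-type duplicate\<close>

text \<open>Removing \<open>V 0 x\<close> from the neighbourhoods of \<open>(x, False)\<close> separates this point from its twin
  \<open>(x, True)\<close>. No other compact set has to be removed, since compact sets of the new topology are closed
  in the Cantor topology.\<close>

definition dup_nbhd :: "cantor rel \<Rightarrow> (cantor \<Rightarrow> nat \<Rightarrow> cantor) \<Rightarrow> nat \<Rightarrow> cantor \<times> bool \<Rightarrow> (cantor \<times> bool) set" where
  "dup_nbhd R t m p = (if snd p then ladder_nbhd R t m (fst p) \<times> {True}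
     else cyl (fst p) m \<times> UNIV - ladder_nbhd R t 0 (fst p) \<times> {True})"

context kunen_ladder
begin

abbreviation N where "N \<equiv> dup_nbhd R t"

lemma dup_True: "N m (x, True) = V m x \<times> {True}"
  by (simp add: dup_nbhd_def)

lemma dup_False: "N m (x, False) = cyl x m \<times> UNIV - V 0 x \<times> {True}"
  by (simp add: dup_nbhd_def)

lemma dup_cyl: "N m (x, c) \<subseteq> cyl x m \<times> UNIV"
  using V_cyl[of m x] by (cases c) (auto simp: dup_True dup_False)

text \<open>Two facts carry the cases: \<open>V m x\<close> is Cantor closed, and near
  \<open>(y, False)\<close> its points lie in \<open>V 0 y\<close>, whose \<open>True\<close> copy
  has been removed.\<close>

lemma clopen_nbhds_dup: "clopen_nbhds N"
proof
  fix p q :: "cantor \<times> bool" and m k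
  obtain x c where p: "p = (x, c)" by (cases p)
  obtain y d where q: "q = (y, d)" by (cases q)
  show "p \<in> N m p"
    by (cases c) (auto simp: p dup_True dup_False V_self cyl_self)
  show "N k p \<subseteq> N m p" if "m \<le> k"
    using V_anti[OF that, of x] cyl_anti[OF that, of x]
    by (cases c) (auto simp: p dup_True dup_False)
  have loc: "\<exists>k. V m x \<inter> cyl y k \<subseteq> V 0 y" for m x y
    by (rule V_local) simp
  show "\<exists>k. N k q \<subseteq> N m p" if "q \<in> N m p"
  proof (cases c)
    case True
    with that obtain k where "V k y \<subseteq> V m x" "d"
      using V_open[of y m x] by (auto simp: p q dup_True)
    then show ?thesis using True by (intro exI[of _ k]) (auto simp: p q dup_True)
  next
    case c: False
    show ?thesis
    proof (cases d)
      case True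
      then have y: "y \<in> cyl x m" "y \<notin> V 0 x" using that c by (auto simp: p q dup_False)
      then obtain k where k: "V 0 x \<inter> cyl y k = {}" using V_closed by blast
      have "V (max k m) y \<subseteq> cyl y k \<inter> cyl y m"
        using V_cyl[of "max k m" y] cyl_anti[of k "max k m" y] cyl_anti[of m "max k m" y] by auto
      then have "N (max k m) q \<subseteq> N m p"
        using k c True cyl_eq[OF y(1)] by (auto simp: p q dup_True dup_False)
      then show ?thesis ..
    next
      case False
      then have y: "y \<in> cyl x m" using that c by (auto simp: p q dup_False)
      obtain k where k: "V 0 x \<inter> cyl y k \<subseteq> V 0 y" using loc by blast
      have "cyl y (max k m) \<subseteq> cyl y k \<inter> cyl x m"
        using cyl_anti[of k "max k m" y] cyl_anti[of m "max k m" y] cyl_eq[OF y] by auto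
      then have "N (max k m) q \<subseteq> N m p"
        using k c False by (auto simp: p q dup_False)
      then show ?thesis ..
    qed
  qed
  show "\<exists>k. N k q \<inter> N m p = {}" if "q \<notin> N m p"
  proof (cases c)
    case c: True
    show ?thesis
    proof (cases d)
      case True
      then have "y \<notin> V m x" using that c by (auto simp: p q dup_True)
      then obtain k where "V m x \<inter> cyl y k = {}" using V_closed by blast
      then show ?thesis using V_cyl[of k y] c True
        by (intro exI[of _ k]) (auto simp: p q dup_True)
    next
      case False
      obtain k where "V m x \<inter> cyl y k \<subseteq> V 0 y" using loc by blast
      then show ?thesis using c False
        by (intro exI[of _ k]) (auto simp: p q dup_True dup_False)
    qed
  next
    case c: False
    show ?thesis
    proof (cases "y \<in> cyl x m")
      case True
      then have "d" "y \<in> V 0 x" using that c by (auto simp: p q dup_False)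
      then obtain k where "V k y \<subseteq> V 0 x" using V_open by blast
      then show ?thesis using c \<open>d\<close>
        by (intro exI[of _ k]) (auto simp: p q dup_True dup_False)
    next
      case False
      then have "cyl y m \<inter> cyl x m = {}" using cyl_eq cyl_self by blast
      then show ?thesis using dup_cyl[of m x c] dup_cyl[of m y d]
        by (intro exI[of _ m]) (auto simp: p q)
    qed
  qed
  show "\<exists>m. q \<notin> N m p" if "p \<noteq> q"
  proof (cases "x = y")
    case True
    then have "c \<noteq> d" using that by (simp add: p q)
    then show ?thesis using True V_self by (cases c) (auto simp: p q dup_True dup_False)
  next
    case False
    then obtain m where "cyl x m \<inter> cyl y m = {}" using cyl_sep by blast
    then have "q \<notin> N m p" using dup_cyl[of m x c] cyl_self[of y m] by (auto simp: p q)
    then show ?thesis ..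
  qed
qed

sublocale dup: clopen_nbhds N
  by (rule clopen_nbhds_dup)

text \<open>Compactness of \<open>V m x\<close> by induction on \<open>x\<close>: a cover member
  around \<open>x\<close> swallows all ladder pieces from some index on, and the finitely many
  earlier ones are compact.\<close>

lemma V_finite_cover:
  assumes "\<And>U. U \<in> \<U> \<Longrightarrow> openin (nbhd_topology N) U" "UNIV \<subseteq> \<Union>\<U>"
  shows "\<exists>\<F>. finite \<F> \<and> \<F> \<subseteq> \<U> \<and> V m x \<times> {True} \<subseteq> \<Union>\<F>"
proof (induction x arbitrary: m rule: wf_induct_rule[OF wf])
  case (1 x)
  obtain U where U: "U \<in> \<U>" "(x, True) \<in> U" using assms(2) by blast
  have "\<exists>k. N k (x, True) \<subseteq> U"
    using assms(1)[OF U(1)] U(2) unfolding dup.openin_nbhd by blast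
  then obtain k where k: "V k x \<times> {True} \<subseteq> U" unfolding dup_True ..
  have "\<forall>l. \<exists>\<F>. (t x l, x) \<in> R \<longrightarrow> finite \<F> \<and> \<F> \<subseteq> \<U> \<and> V l (t x l) \<times> {True} \<subseteq> \<Union>\<F>"
    using 1 by meson
  then obtain \<F> where \<F>: "\<And>l. (t x l, x) \<in> R \<Longrightarrow> finite (\<F> l)"
    "\<And>l. (t x l, x) \<in> R \<Longrightarrow> \<F> l \<subseteq> \<U>"
    "\<And>l. (t x l, x) \<in> R \<Longrightarrow> V l (t x l) \<times> {True} \<subseteq> \<Union>(\<F> l)"
    by metis
  define \<G> where "\<G> = insert U (\<Union>l\<in>{l. l < k \<and> (t x l, x) \<in> R}. \<F> l)"
  have "finite \<G>" unfolding \<G>_def using \<F>(1) by simp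
  moreover have "\<G> \<subseteq> \<U>" unfolding \<G>_def using \<F>(2) U by blast
  moreover have "(z, True) \<in> \<Union>\<G>" if z: "z \<in> V m x" for z
  proof (cases "z = x")
    case True
    then show ?thesis using U unfolding \<G>_def by blast
  next
    case False
    then obtain l where l: "(t x l, x) \<in> R" "z \<in> V l (t x l)" 
      using z V_unfold[of m x] by blast
    show ?thesis
    proof (cases "l < k")
      case True
      then show ?thesis using \<F>(3)[OF l(1)] l unfolding \<G>_def by blast
    next
      case False
      then have "z \<in> V k x" using l V_step[of k l x] by auto
      then show ?thesis using k unfolding \<G>_def by blast
    qed
  qed
  ultimately show ?case by blast
qed

text \<open>Finitely many neighbourhoods of \<open>False\<close> points cover everything except
  points in finitely many sets \<open>V 0 x \<times> {True}\<close>, which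
  \<open>V_finite_cover\<close> handles.\<close>

lemma compact_dup: "compact_space (nbhd_topology N)"
  unfolding compact_space_def compactin_def
proof (intro conjI allI impI)
  fix \<U> assume "(\<forall>U\<in>\<U>. openin (nbhd_topology N) U) \<and> topspace (nbhd_topology N) \<subseteq> \<Union>\<U>"
  then have \<U>: "\<And>U. U \<in> \<U> \<Longrightarrow> openin (nbhd_topology N) U" "UNIV \<subseteq> \<Union>\<U>" by simp_all
  have "\<exists>U m. U \<in> \<U> \<and> N m (x, False) \<subseteq> U" for x
  proof -
    obtain U where "U \<in> \<U>" "(x, False) \<in> U" using \<U>(2) by blast
    then show ?thesis using \<U>(1) unfolding dup.openin_nbhd by blast
  qed
  then obtain U m where U: "\<And>x. U x \<in> \<U>" "\<And>x. N (m x) (x, False) \<subseteq> U x" by metis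
  obtain F where F: "finite F" "(\<Union>x\<in>F. cyl x (m x)) = UNIV" using cyl_compact[of m] by blast
  obtain \<F> where \<F>: "\<And>x. finite (\<F> x)" "\<And>x. \<F> x \<subseteq> \<U>" "\<And>x. V 0 x \<times> {True} \<subseteq> \<Union>(\<F> x)"
    using V_finite_cover[OF \<U>] by metis
  show "\<exists>\<F>. finite \<F> \<and> \<F> \<subseteq> \<U> \<and> topspace (nbhd_topology N) \<subseteq> \<Union>\<F>"
  proof (intro exI[of _ "U ` F \<union> (\<Union>x\<in>F. \<F> x)"] conjI subsetI)
    fix p :: "cantor \<times> bool"
    obtain y d where p: "p = (y, d)" by (cases p)
    obtain x where x: "x \<in> F" "y \<in> cyl x (m x)" using F(2) by blast
    show "p \<in> \<Union>(U ` F \<union> (\<Union>x\<in>F. \<F> x))"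
    proof (cases "d \<and> y \<in> V 0 x")
      case True
      then have "p \<in> \<Union>(\<F> x)" using \<F>(3)[of x] p by blast
      then show ?thesis using x(1) by blast
    next
      case False
      then have "p \<in> U x" using U(2)[of x] x(2) by (auto simp: p dup_False)
      then show ?thesis using x(1) by blast
    qed
  qed (use F(1) \<F>(1,2) U(1) in auto)
qed simp

lemma ex_True_in_dup: "\<exists>y. (y, True) \<in> N m q"
proof (cases q)
  case (Pair x c)
  show ?thesis
  proof (cases c)
    case True
    then show ?thesis using V_self by (auto simp: Pair dup_True)
  next
    case False
    \<comment> \<open>The cylinder is uncountable, while the removed set is countable.\<close>
    have "\<not> cyl x m \<subseteq> V 0 x" using uncountable_cyl countable_V countable_subset by blast
    then show ?thesis using False by (auto simp: Pair dup_False)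
  qed
qed

text \<open>The \<open>True\<close> copy is scattered: the \<open>R\<close>-least point of an open set is isolated.\<close>

lemma dup_isolated_dense: "\<exists>p\<in>N m q. \<exists>k. N k p = {p}"
proof -
  obtain y where "(y, True) \<in> N m q" using ex_True_in_dup by blast
  then obtain k where k: "V k y \<times> {True} \<subseteq> N m q" using dup.nbhd_open by (metis dup_True)
  obtain z where z: "z \<in> V k y" "\<And>w. (w, z) \<in> R \<Longrightarrow> w \<notin> V k y"
    using wfE_min[OF wf V_self] by metis
  then obtain l where "V l z \<subseteq> V k y" using V_open by blast
  then have "V l z = {z}" using z(2) V_below[of l z] V_self[of z l] by blast
  then have "N l (z, True) = {(z, True)}" by (simp add: dup_True)
  then show ?thesis using k z(1) by blast
qed

lemma dup_not_discrete: "\<exists>x. \<forall>m. N m x \<noteq> {x}"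
proof -
  have "N m (x, False) \<noteq> {(x, False)}" for m x
    using ex_True_in_dup[of m "(x, False)"] by auto
  then show ?thesis by blast
qed

sublocale dup: compact_clopen_nbhds N
  by unfold_locales (rule compact_dup dup_isolated_dense dup_not_discrete)+

sublocale dup_power: clopen_nbhds "power_nbhd N"
  by (rule dup.clopen_nbhds_power)

section \<open>The S-space properties of the countable power of the duplicate\<close>

lemma dup_tuples_dense:
  fixes A :: "(nat \<Rightarrow> cantor \<times> bool) set"
  shows "\<exists>D\<subseteq>A. countable D \<and> (\<forall>a\<in>A. \<forall>m. \<exists>d\<in>D. \<forall>i<n. d i \<in> N m (a i))"
proof -
  let ?fst = "\<lambda>(a :: nat \<Rightarrow> cantor \<times> bool) i. fst (a i)"
  \<comment> \<open>\<open>A\<close> splits into finitely many parts according to which coordinates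
    lie in the \<open>True\<close> copy; there \<open>mixed_dense\<close> asks for new
    neighbourhoods, elsewhere for cylinders.\<close>
  define B where "B = (\<lambda>J. {a \<in> A. \<forall>i<n. snd (a i) \<longleftrightarrow> i \<in> J})"
  have "\<exists>D\<subseteq>B J. countable D \<and> (\<forall>a\<in>B J. \<forall>m. \<exists>d\<in>D. \<forall>i<n. d i \<in> N m (a i))"
    if J: "J \<in> Pow {..<n}" for J
  proof -
    obtain D' where D': "D' \<subseteq> ?fst ` B J" "countable D'"
      "\<And>a m. a \<in> ?fst ` B J \<Longrightarrow>
         \<exists>d\<in>D'. \<forall>i<n. d i \<in> (if i \<in> J then V m (a i) else cyl (a i) m)"
    proof -
      have "finite J" "J \<subseteq> {..<n}" using J finite_subset by auto
      from mixed_dense[OF this, of "?fst ` B J"] show thesis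
        using that by metis
    qed
    obtain D where D: "D \<subseteq> B J" "countable D" "D' = ?fst ` D"
      using D'(1,2) by (metis countable_subset_image)
    have "\<exists>d\<in>D. \<forall>i<n. d i \<in> N m (a i)" if a: "a \<in> B J" for a m
    proof -
      have "\<exists>d\<in>D'. \<forall>i<n. d i \<in> (if i \<in> J then V m (fst (a i)) else cyl (fst (a i)) m)"
        using D'(3)[OF imageI[OF a]] .
      then obtain d where d: "d \<in> D"
        "\<forall>i<n. fst (d i) \<in> (if i \<in> J then V m (fst (a i)) else cyl (fst (a i)) m)"
        using D(3) by blast
      have "d i \<in> N m (a i)" if "i < n" for i
      proof -
        have "snd (a i) \<longleftrightarrow> i \<in> J" "snd (d i) \<longleftrightarrow> i \<in> J"
          using a d(1) D(1) that unfolding B_def by auto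
        \<comment> \<open>If \<open>a i\<close> has flag \<open>False\<close>, so does
          \<open>d i\<close>; the removed part of the neighbourhood then does not affect it.\<close>
        then show ?thesis using d(2) that unfolding dup_nbhd_def
          by (cases "d i") auto
      qed
      with d(1) show ?thesis by blast
    qed
    with D(1,2) show ?thesis by blast
  qed
  then obtain D where D: "\<And>J. J \<in> Pow {..<n} \<Longrightarrow> D J \<subseteq> B J" "\<And>J. J \<in> Pow {..<n} \<Longrightarrow> countable (D J)"
      "\<And>J a m. J \<in> Pow {..<n} \<Longrightarrow> a \<in> B J \<Longrightarrow> \<exists>d\<in>D J. \<forall>i<n. d i \<in> N m (a i)"
    by metis
  show ?thesis
  proof (intro exI[of _ "\<Union>J\<in>Pow {..<n}. D J"] conjI ballI allI)
    show "(\<Union>J\<in>Pow {..<n}. D J) \<subseteq> A" using D(1) unfolding B_def by blast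
    show "countable (\<Union>J\<in>Pow {..<n}. D J)"
      by (intro countable_UN D(2) countable_finite) auto
    fix a m assume "a \<in> A"
    define J where "J = {i. i < n \<and> snd (a i)}"
    have J: "J \<in> Pow {..<n}" "a \<in> B J" using \<open>a \<in> A\<close> by (auto simp: J_def B_def)
    obtain d where "d \<in> D J" "\<forall>i<n. d i \<in> N m (a i)" using D(3)[OF J, of m] by metis
    then show "\<exists>d\<in>\<Union>J\<in>Pow {..<n}. D J. \<forall>i<n. d i \<in> N m (a i)"
      using J(1) by (metis UN_I)
  qed
qed

lemma hereditarily_separable_dup_power: "hereditarily_separable (nbhd_topology (power_nbhd N))"
proof (rule dup_power.hereditarily_separable_nbhd)
  fix A :: "(nat \<Rightarrow> cantor \<times> bool) set"
  obtain D where D: "\<And>n. D n \<subseteq> A" "\<And>n. countable (D n)"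
      "\<And>n a m. a \<in> A \<Longrightarrow> \<exists>d\<in>D n. \<forall>i<n. d i \<in> N m (a i)"
    using dup_tuples_dense[of A] by metis
  show "\<exists>D\<subseteq>A. countable D \<and> (\<forall>a\<in>A. \<forall>m. D \<inter> power_nbhd N m a \<noteq> {})"
  proof (intro exI[of _ "\<Union>n. D n"] conjI ballI allI)
    fix a m assume "a \<in> A"
    then obtain d where "d \<in> D m" "\<forall>i<m. d i \<in> N m (a i)" using D(3) by blast
    then show "(\<Union>n. D n) \<inter> power_nbhd N m a \<noteq> {}" unfolding power_nbhd_def by blast
  qed (use D in auto)
qed

lemma not_Lindelof_dup_power:
  "\<not> Lindelof_space (subtopology (nbhd_topology (power_nbhd N)) {z. snd (z 0)})"
proof
  let ?S = "{z :: nat \<Rightarrow> cantor \<times> bool. snd (z 0)}"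
  let ?Z = "nbhd_topology (power_nbhd N)"
  define U where "U = (\<lambda>x. {z :: nat \<Rightarrow> cantor \<times> bool. z 0 \<in> V 0 x \<times> {True}})"
  assume L: "Lindelof_space (subtopology ?Z ?S)"
  have "openin ?Z (U x)" for x
    unfolding dup_power.openin_nbhd
  proof
    fix z assume "z \<in> U x"
    then have "z 0 \<in> N 0 (x, True)" by (simp add: U_def dup_True)
    then obtain k where "N k (z 0) \<subseteq> N 0 (x, True)" using dup.nbhd_open by blast
    then have "power_nbhd N (Suc k) z \<subseteq> U x"
      using dup.nbhd_anti[of k "Suc k" "z 0"] by (fastforce simp: power_nbhd_def U_def dup_True)
    then show "\<exists>m. power_nbhd N m z \<subseteq> U x" ..
  qed
  moreover have "U x = U x \<inter> ?S" for x by (auto simp: U_def)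
  ultimately have "openin (subtopology ?Z ?S) (U x)" for x
    unfolding openin_subtopology by blast
  moreover have "\<Union>(range U) = topspace (subtopology ?Z ?S)"
  proof -
    have "z \<in> U (fst (z 0))" if "snd (z 0)" for z
      using that V_self[of "fst (z 0)" 0] by (simp add: U_def mem_Times_iff)
    moreover have "U x \<subseteq> ?S" for x by (auto simp: U_def)
    ultimately show ?thesis by auto
  qed
  ultimately have "\<exists>\<V>. countable \<V> \<and> \<V> \<subseteq> range U \<and> \<Union>\<V> = topspace (subtopology ?Z ?S)"
    by (intro Lindelof_spaceD[OF L]) auto
  then obtain \<V> where \<V>: "countable \<V>" "\<V> \<subseteq> range U" "\<Union>\<V> = ?S"
    by auto
  obtain F where F: "countable F" "\<V> = U ` F" using \<V>(1,2) by (metis countable_subset_image)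
  \<comment> \<open>Countably many members of the cover allow only countably many values of
    coordinate \<open>0\<close>, while the subspace has uncountably many.\<close>
  have "countable (\<Union>x\<in>F. V 0 x)" using F(1) countable_V by blast
  then obtain y where y: "y \<notin> (\<Union>x\<in>F. V 0 x)" using uncountable_cantor by (metis UNIV_eq_I)
  have "(\<lambda>_. (y, True)) \<in> \<Union>\<V>" unfolding \<V>(3) by simp
  then show False using y unfolding F(2) U_def by auto
qed

lemma S_space_dup_power: "S_space (nbhd_topology (power_nbhd N))"
  unfolding S_space_def
proof (intro conjI exI)
  show "regular_space (nbhd_topology (power_nbhd N))"
    using dup.power_compact dup_power.Hausdorff_nbhd compact_Hausdorff_imp_regular_space by blast
qed (rule dup_power.Hausdorff_nbhd hereditarily_separable_dup_power not_Lindelof_dup_power | simp)+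

end

section \<open>Homeomorphism invariance and finite powers\<close>

lemma homeomorphic_space_subtopology:
  assumes "X homeomorphic_space Y" "S \<subseteq> topspace Y"
  shows "\<exists>T\<subseteq>topspace X. subtopology X T homeomorphic_space subtopology Y S"
proof -
  obtain f where f: "homeomorphic_map Y X f"
    using assms(1) homeomorphic_space homeomorphic_space_sym by blast
  have "homeomorphic_map (subtopology Y S) (subtopology X (f ` S)) f"
    by (rule homeomorphic_map_subtopologies[OF f])
      (use assms(2) homeomorphic_imp_surjective_map[OF f] in blast)
  then show ?thesis
    using homeomorphic_map_imp_homeomorphic_space homeomorphic_space_sym assms(2)
      homeomorphic_imp_surjective_map[OF f] by (metis image_mono)
qed

lemma S_space_homeomorphic:
  assumes "X homeomorphic_space Y" "S_space X"
  shows "S_space Y"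
proof -
  have "hereditarily_separable Y" unfolding hereditarily_separable_def
  proof (intro allI impI)
    fix S assume "S \<subseteq> topspace Y"
    then obtain T where "T \<subseteq> topspace X" "subtopology X T homeomorphic_space subtopology Y S"
      using homeomorphic_space_subtopology[OF assms(1)] by blast
    then show "separable_space (subtopology Y S)"
      using assms(2) homeomorphic_separable_space unfolding S_space_def hereditarily_separable_def by blast
  qed
  moreover obtain S where S: "S \<subseteq> topspace X" "\<not> Lindelof_space (subtopology X S)"
    using assms(2) unfolding S_space_def by blast
  then obtain T where T: "T \<subseteq> topspace Y" "subtopology Y T homeomorphic_space subtopology X S"
    using homeomorphic_space_subtopology[of Y X S] assms(1) homeomorphic_space_sym by blast
  then obtain f where "homeomorphic_map (subtopology Y T) (subtopology X S) f"
    using homeomorphic_space by blast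
  then have "\<not> Lindelof_space (subtopology Y T)"
    using S(2) Lindelof_space_continuous_map_image[of _ _ f] homeomorphic_imp_continuous_map[of _ _ f]
      homeomorphic_imp_surjective_map[of _ _ f] by meson
  ultimately show ?thesis
    using assms T(1) homeomorphic_regular_space homeomorphic_Hausdorff_space
    unfolding S_space_def by blast
qed

lemma zero_dimensional_homeomorphic:
  assumes "X homeomorphic_space Y" "zero_dimensional X"
  shows "zero_dimensional Y"
  unfolding zero_dimensional_def
proof (intro allI impI)
  fix U y assume U: "openin Y U \<and> y \<in> U"
  obtain f g where fg: "homeomorphic_maps X Y f g" using assms(1) unfolding homeomorphic_space_def by blast
  then have f: "homeomorphic_map X Y f" and g: "homeomorphic_map Y X g"
    and y: "\<And>y. y \<in> topspace Y \<Longrightarrow> f (g y) = y"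
    by (auto simp: homeomorphic_maps_map)
  have sub: "U \<subseteq> topspace Y" using U openin_subset by blast
  have "openin X (g ` U)" using homeomorphic_map_openness_eq[OF g] U by blast
  then obtain V where V: "openin X V" "closedin X V" "g y \<in> V" "V \<subseteq> g ` U"
    using assms(2) U unfolding zero_dimensional_def by blast
  have "openin Y (f ` V)" "closedin Y (f ` V)"
    using homeomorphic_map_openness_eq[OF f] homeomorphic_map_closedness_eq[OF f] V by blast+
  moreover have "y \<in> f ` V" using V(3) y U sub by (metis imageI subsetD)
  moreover have "f ` V \<subseteq> U"
  proof
    fix w assume "w \<in> f ` V"
    then obtain u where "u \<in> U" "w = f (g u)" using V(4) by blast
    then show "w \<in> U" using y sub by auto
  qed
  ultimately show "\<exists>V. openin Y V \<and> closedin Y V \<and> y \<in> V \<and> V \<subseteq> U" by blast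
qed

lemma homogeneous_space_homeomorphic:
  assumes "X homeomorphic_space Y" "homogeneous_space X"
  shows "homogeneous_space Y"
  unfolding homogeneous_space_def
proof (intro ballI)
  fix x y assume xy: "x \<in> topspace Y" "y \<in> topspace Y"
  obtain f g where fg: "homeomorphic_maps X Y f g" using assms(1) unfolding homeomorphic_space_def by blast
  then have f: "homeomorphic_map X Y f" and g: "homeomorphic_map Y X g"
    and fgy: "\<And>y. y \<in> topspace Y \<Longrightarrow> f (g y) = y"
    by (auto simp: homeomorphic_maps_map)
  have "g x \<in> topspace X" "g y \<in> topspace X"
    using xy homeomorphic_imp_surjective_map[OF g] by blast+
  then obtain h where h: "homeomorphic_map X X h" "h (g x) = g y"
    using assms(2) unfolding homogeneous_space_def by blast
  have "homeomorphic_map Y Y (f \<circ> h \<circ> g)"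
    using f g h(1) homeomorphic_map_compose by metis
  moreover have "(f \<circ> h \<circ> g) x = y" using h(2) fgy xy by simp
  ultimately show "\<exists>f. homeomorphic_map Y Y f \<and> f x = y" by blast
qed

text \<open>Division with remainder identifies pairs (factor \<open>i\<close>, coordinate
  \<open>k\<close>) with the single coordinate \<open>k * n + i\<close>.\<close>

lemma homeomorphic_space_finite_power:
  fixes n :: nat
  assumes "n \<ge> 1"
  shows "product_topology (\<lambda>_. product_topology (\<lambda>_. X) (UNIV :: nat set)) {..<n} homeomorphic_space
    product_topology (\<lambda>_. X) (UNIV :: nat set)"
    (is "?P homeomorphic_space ?Z")
proof -
  define f where "f = (\<lambda>(w :: nat \<Rightarrow> nat \<Rightarrow> 'a) j. w (j mod n) (j div n))"
  define g where "g = (\<lambda>(z :: nat \<Rightarrow> 'a). \<lambda>i\<in>{..<n}. \<lambda>k. z (k * n + i))"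
  have "continuous_map ?P ?Z f"
    unfolding continuous_map_componentwise_UNIV f_def
  proof
    fix j
    have "continuous_map ?P ?Z (\<lambda>w. w (j mod n))"
      using assms by (intro continuous_map_product_projection) simp
    then show "continuous_map ?P X (\<lambda>w. w (j mod n) (j div n))"
      by (simp add: continuous_map_componentwise_UNIV)
  qed
  moreover have "continuous_map ?Z ?P g"
    unfolding continuous_map_componentwise g_def
    by (auto simp: continuous_map_componentwise_UNIV intro!: continuous_map_product_projection)
  moreover have "g (f w) = w" if "w \<in> topspace ?P" for w
  proof
    fix i
    show "g (f w) i = w i"
    proof (cases "i < n")
      case True then show ?thesis by (simp add: f_def g_def)
    next
      case False then show ?thesis using that by (auto simp: g_def PiE_iff extensional_def)
    qed
  qed
  moreover have "f (g z) = z" for z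
    using assms by (auto simp: f_def g_def fun_eq_iff)
  ultimately show ?thesis
    unfolding homeomorphic_space_def homeomorphic_maps_def by blast
qed

lemma continuous_map_power:
  assumes "continuous_map A B u"
  shows "continuous_map (product_topology (\<lambda>_. A) I) (product_topology (\<lambda>_. B) I) (\<lambda>w. \<lambda>i\<in>I. u (w i))"
  unfolding continuous_map_componentwise
proof (intro conjI ballI)
  fix i assume "i \<in> I"
  then have "continuous_map (product_topology (\<lambda>_. A) I) A (\<lambda>w. w i)"
    by (rule continuous_map_product_projection)
  then have "continuous_map (product_topology (\<lambda>_. A) I) B (\<lambda>w. u (w i))"
    using assms continuous_map_compose[of _ A "\<lambda>w. w i" B u] by (simp add: o_def)
  then show "continuous_map (product_topology (\<lambda>_. A) I) B (\<lambda>w. (\<lambda>i\<in>I. u (w i)) i)"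
    using \<open>i \<in> I\<close> by simp
qed auto

lemma homeomorphic_space_product:
  assumes "X homeomorphic_space Y"
  shows "product_topology (\<lambda>_. X) I homeomorphic_space product_topology (\<lambda>_. Y) I"
proof -
  obtain f g where fg: "continuous_map X Y f" "continuous_map Y X g"
    "\<And>x. x \<in> topspace X \<Longrightarrow> g (f x) = x" "\<And>y. y \<in> topspace Y \<Longrightarrow> f (g y) = y"
    using assms unfolding homeomorphic_space_def homeomorphic_maps_def by blast
  show ?thesis
    unfolding homeomorphic_space_def homeomorphic_maps_def
  proof (intro exI conjI ballI)
    show "continuous_map (product_topology (\<lambda>_. X) I) (product_topology (\<lambda>_. Y) I) (\<lambda>w. \<lambda>i\<in>I. f (w i))"
      by (rule continuous_map_power, rule fg)
    show "continuous_map (product_topology (\<lambda>_. Y) I) (product_topology (\<lambda>_. X) I) (\<lambda>w. \<lambda>i\<in>I. g (w i))"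
      by (rule continuous_map_power, rule fg)
  next
    fix w assume "w \<in> topspace (product_topology (\<lambda>_. X) I)"
    then show "(\<lambda>i\<in>I. g ((\<lambda>i\<in>I. f (w i)) i)) = w"
      using fg(3) by (auto simp: fun_eq_iff PiE_iff extensional_def restrict_def)
  next
    fix w assume "w \<in> topspace (product_topology (\<lambda>_. Y) I)"
    then show "(\<lambda>i\<in>I. f ((\<lambda>i\<in>I. g (w i)) i)) = w"
      using fg(4) by (auto simp: fun_eq_iff PiE_iff extensional_def restrict_def)
  qed
qed

text \<open>Allows the space to be transported to the reals. In block \<open>i\<close> of the
  coding, slot \<open>0\<close> stores the flag and slot \<open>Suc j\<close> stores bit
  \<open>j\<close>.\<close>

lemma power_eqpoll_reals: "(UNIV :: (nat \<Rightarrow> cantor \<times> bool) set) \<approx> (UNIV :: real set)"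
proof -
  have "inj (\<lambda>(z :: nat \<Rightarrow> cantor \<times> bool) n. case prod_decode n of (i, k) \<Rightarrow>
      case k of 0 \<Rightarrow> snd (z i) | Suc j \<Rightarrow> fst (z i) j)" (is "inj ?c")
  proof (rule injI)
    fix z w :: "nat \<Rightarrow> cantor \<times> bool" assume eq: "?c z = ?c w"
    show "z = w"
    proof
      fix i
      have "snd (z i) = snd (w i)" using fun_cong[OF eq, of "prod_encode (i, 0)"] by simp
      moreover have "fst (z i) j = fst (w i) j" for j
        using fun_cong[OF eq, of "prod_encode (i, Suc j)"] by simp
      ultimately show "z i = w i" by (simp add: prod_eq_iff fun_eq_iff)
    qed
  qed
  then have "(UNIV :: (nat \<Rightarrow> cantor \<times> bool) set) \<lesssim> (UNIV :: cantor set)"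
    unfolding lepoll_def by blast
  moreover have "inj (\<lambda>x (_::nat). (x :: cantor, True))"
    by (rule injI) (meson fun_cong prod.inject)
  then have "(UNIV :: cantor set) \<lesssim> (UNIV :: (nat \<Rightarrow> cantor \<times> bool) set)"
    unfolding lepoll_def by blast
  ultimately show ?thesis using lepoll_antisym cantor_eqpoll_reals eqpoll_trans by blast
qed

lemma homeomorphic_pullback_bij:
  assumes "bij f" "topspace Z = UNIV"
  shows "pullback_topology UNIV f Z homeomorphic_space Z"
proof (rule homeomorphic_map_imp_homeomorphic_space, rule bijective_open_imp_homeomorphic_map)
  show "continuous_map (pullback_topology UNIV f Z) Z f"
    using assms by (auto simp: continuous_map openin_pullback_topology topspace_pullback_topology)
  show "open_map (pullback_topology UNIV f Z) Z f"
    unfolding open_map_def openin_pullback_topology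
    using assms(1) by (auto simp: bij_is_surj surj_image_vimage_eq)
  show "f ` topspace (pullback_topology UNIV f Z) = topspace Z"
    using assms by (simp add: topspace_pullback_topology bij_is_surj)
  show "inj_on f (topspace (pullback_topology UNIV f Z))"
    using assms by (meson bij_is_inj inj_on_subset subset_UNIV)
qed

theorem theorem4p2:
  assumes "CH"
  shows "\<exists>X :: real topology. first_countable X \<and> zero_dimensional X \<and> compact_space X \<and>
           homogeneous_space X \<and> strong_S_space X"
proof -
  obtain R :: "cantor rel" where R: "wf R" "trans R" "total R" "\<forall>x. countable {y. (y, x) \<in> R}"
    by (rule CH_wellorder[OF assms])
  obtain t where t: "\<forall>x. catches R t x (t x)" using ladder_exists R by blast
  interpret kunen_ladder R t using R t by unfold_locales auto
  let ?Z = "nbhd_topology (power_nbhd N)"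
  obtain f :: "real \<Rightarrow> nat \<Rightarrow> cantor \<times> bool" where "bij f"
    using power_eqpoll_reals eqpoll_sym unfolding eqpoll_def by blast
  define X where "X = pullback_topology UNIV f ?Z"
  have XZ: "X homeomorphic_space ?Z"
    unfolding X_def by (rule homeomorphic_pullback_bij) (simp_all add: \<open>bij f\<close>)
  then have ZX: "?Z homeomorphic_space X" by (rule homeomorphic_space_sym[THEN iffD1])
  have "S_space (product_topology (\<lambda>_. X) {..<n})" if "n \<ge> 1" for n :: nat
  proof -
    \<comment> \<open>Every finite power of \<open>X\<close> is homeomorphic to \<open>?Z\<close>
      itself, so one S-space proof serves all \<open>n\<close>.\<close>
    have "product_topology (\<lambda>_. X) {..<n} homeomorphic_space product_topology (\<lambda>_. ?Z) {..<n}"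
      by (rule homeomorphic_space_product[OF XZ])
    also have "\<dots> homeomorphic_space ?Z"
      using homeomorphic_space_finite_power[OF that, of "nbhd_topology N"]
      by (simp only: dup.product_topology_nbhd)
    finally show ?thesis
      using S_space_homeomorphic S_space_dup_power homeomorphic_space_sym by blast
  qed
  then have "strong_S_space X" unfolding strong_S_space_def by blast
  moreover have "first_countable X"
    using homeomorphic_space_first_countability[OF XZ] dup_power.first_countable_nbhd by blast
  moreover have "zero_dimensional X"
    using zero_dimensional_homeomorphic[OF ZX] dup_power.zero_dimensional_nbhd by blast
  moreover have "compact_space X"
    using homeomorphic_compact_space[OF XZ] dup.power_compact by blast
  moreover have "homogeneous_space X"
    using homogeneous_space_homeomorphic[OF ZX] dup.homogeneous_power by blast
  ultimately show ?thesis by blast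
qed

end
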